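(* Let $\bar A=(A_0,A_1)$ be a compatible couple of (quasi-)Banach spaces with $A_0\cap A_1\neq\{0\}$. Let $0<q_1,r_1\le\infty$ and $a_1,b_1\in SV$ be such that $\|s^{-1/r_1}b_1(s)\|_{r_1,(1,\infty)}<\infty$ and $\left\|s^{-1/r_1}b_1(s)\|u^{-1/q_1}a_1(u)\|_{q_1,(0,s)}\right\|_{r_1,(0,1)}<\infty$, and put $$\chi_1(t)=\left\|s^{-1/r_1}b_1(s)\|u^{-1/q_1}a_1(u)\|_{q_1,(0,s)}\right\|_{r_1,(0,t)}+\|s^{-1/r_1}b_1(s)\|_{r_1,(t,\infty)}\|u^{-1/q_1}a_1(u)\|_{q_1,(0,t)}.$$ Let $0<r_0,q_0\le\infty$, $a_0,b_0\in SV$, and $\left\|s^{-1/r_0}b_0(s)\|u^{-1/q_0}a_0(u)\|_{q_0,(1,s)}\right\|_{r_0,(1,\infty)}<\infty$. Put $$\chi_0(t)=\left\|s^{-1/r_0}b_0(s)\|u^{-1/q_0}a_0(u)\|_{q_0,(t,s)}\right\|_{r_0,(t,\infty)}$$ and $\rho(t)=t\frac{\chi_0(t)}{\chi_1(t)}$. Then, for all $f\in\bar A^{\mathcal L}_{0,r_0,b_0,q_0,a_0}+\bar A^{\mathcal L}_{1,r_1,b_1,q_1,a_1}$ and $t>0$, $$\begin{aligned}K\left(\rho(t),f;\bar A^{\mathcal L}_{0,r_0,b_0,q_0,a_0},\bar A^{\mathcal L}_{1,r_1,b_1,q_1,a_1}\right)\approx{}&\left\|s^{-1/r_0}b_0(s)\|u^{-1/q_0}a_0(u)K(u,f)\|_{q_0,(0,s)}\right\|_{r_0,(0,t)}\\&+\|s^{-1/r_0}b_0(s)\|_{r_0,(t,\infty)}\|u^{-1/q_0}a_0(u)K(u,f)\|_{q_0,(0,t)}\\&+\rho(t)\left\|s^{-1/r_1}b_1(s)\|u^{-1-1/q_1}a_1(u)K(u,f)\|_{q_1,(t,s)}\right\|_{r_1,(t,\infty)}+\chi_0(t)K(t,f),\end{aligned}$$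 with equivalence constants independent of $f$ and $t$.
   Context: Conventions: $1/\infty=0$; $\|\cdot\|_{q,(a,b)}$ is the usual (quasi-)norm of $L_q$ on the interval $(a,b)$, $0<q\le\infty$. $F\approx G$ means $C^{-1}G\le F\le CG$ for some constant $C>0$ independent of all significant quantities. $b\in SV$ (slowly varying) means that $b$ is a positive Lebesgue measurable function on $(0,\infty)$ such that for each $\varepsilon>0$ the function $t^{\varepsilon}b(t)$ is equivalent ($\approx$) to an increasing function and $t^{-\varepsilon}b(t)$ is equivalent to a decreasing function. For a compatible couple $(X_0,X_1)$ of (quasi-)normed spaces, $K(t,f;X_0,X_1)=\inf\{\|f_0\|_{X_0}+t\|f_1\|_{X_1}: f=f_0+f_1,\ f_i\in X_i\}$ for $f\in X_0+X_1$, $t>0$; $K(t,f):=K(t,f;A_0,A_1)$. For $0\le\theta\le1$, $0<r,q\le\infty$, $a,b\in SV$, $\bar A^{\mathcal L}_{\theta,r,b,q,a}$ is the space of all $f\in A_0+A_1$ with finite (quasi-)norm $\left\|t^{-1/r}b(t)\|u^{-\theta-1/q}a(u)K(u,f)\|_{q,(0,t)}\right\|_{r,(0,\infty)}$. Standing assumption: none of the spaces under consideration is $\{0\}$. *)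

theory Defs
  imports "HOL-Analysis.Analysis" "HOL-Probability.Essential_Supremum"
begin

text \<open>Hausdorff topological vector spaces over the reals, the ambient spaces of compatible couples.
  A complex space is covered by restricting scalars: this changes neither the (quasi-)norms nor
  the K-functional.\<close>

class real_tvs = real_vector + topological_ab_group_add + t2_space +
  assumes tendsto_scaleR_Pair:
    "LIM p (nhds c \<times>\<^sub>F nhds x). fst p *\<^sub>R snd p :> nhds (c *\<^sub>R x)"

text \<open>A quasi-normed space inside an ambient vector space is given by its set of points and its
  quasi-norm. The quasi-norm takes values in \<^typ>\<open>ennreal\<close>, is finite on the points, and its
  values outside of them are irrelevant.\<close>

datatype 'v qspace = QSpace (pts: "'v set") (qnorm: "'v \<Rightarrow> ennreal")

definition quasi_normed :: "'v::real_vector qspace \<Rightarrow> bool" where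
  "quasi_normed X \<longleftrightarrow>
     subspace (pts X) \<and>
     (\<forall>x\<in>pts X. qnorm X x < \<infinity>) \<and>
     (\<forall>x\<in>pts X. qnorm X x = 0 \<longleftrightarrow> x = 0) \<and>
     (\<forall>x\<in>pts X. \<forall>c. qnorm X (c *\<^sub>R x) = ennreal \<bar>c\<bar> * qnorm X x) \<and>
     (\<exists>C\<ge>1. \<forall>x\<in>pts X. \<forall>y\<in>pts X. qnorm X (x + y) \<le> ennreal C * (qnorm X x + qnorm X y))"

definition quasi_complete :: "'v::real_vector qspace \<Rightarrow> bool" where
  "quasi_complete X \<longleftrightarrow>
     (\<forall>s::nat \<Rightarrow> 'v.
        (\<forall>n. s n \<in> pts X) \<and> (\<forall>e>0. \<exists>N. \<forall>m\<ge>N. \<forall>n\<ge>N. qnorm X (s m - s n) < e) \<longrightarrow>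
        (\<exists>x\<in>pts X. (\<lambda>n. qnorm X (s n - x)) \<longlonglongrightarrow> 0))"

definition quasi_banach :: "'v::real_vector qspace \<Rightarrow> bool" where
  "quasi_banach X \<longleftrightarrow> quasi_normed X \<and> quasi_complete X"

text \<open>Continuity at the origin suffices, because the inclusion map is linear.\<close>

definition continuously_embedded :: "'v::real_tvs qspace \<Rightarrow> bool" where
  "continuously_embedded X \<longleftrightarrow>
     (\<forall>U. open U \<and> 0 \<in> U \<longrightarrow> (\<exists>e>0. \<forall>x\<in>pts X. qnorm X x < e \<longrightarrow> x \<in> U))"

definition compatible_couple :: "'v::real_tvs qspace \<Rightarrow> 'v qspace \<Rightarrow> bool" where
  "compatible_couple A0 A1 \<longleftrightarrow>
     quasi_banach A0 \<and> quasi_banach A1 \<and> continuously_embedded A0 \<and> continuously_embedded A1"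

definition sum_pts :: "'v::real_vector qspace \<Rightarrow> 'v qspace \<Rightarrow> 'v set" where
  "sum_pts X0 X1 = {f0 + f1 | f0 f1. f0 \<in> pts X0 \<and> f1 \<in> pts X1}"

definition K_fun :: "ennreal \<Rightarrow> 'v::real_vector \<Rightarrow> 'v qspace \<Rightarrow> 'v qspace \<Rightarrow> ennreal" where
  "K_fun t f X0 X1 =
     Inf {qnorm X0 f0 + t * qnorm X1 f1 | f0 f1. f0 \<in> pts X0 \<and> f1 \<in> pts X1 \<and> f = f0 + f1}"

text \<open>Powers of extended non-negative numbers, meant for exponents \<open>p > 0\<close>.\<close>

definition ennpowr :: "ennreal \<Rightarrow> real \<Rightarrow> ennreal" where
  "ennpowr x p = (if x = \<infinity> then \<infinity> else ennreal (enn2real x powr p))"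

text \<open>The (quasi-)norm of \<open>L\<^sub>q(I)\<close> for \<open>0 < q \<le> \<infinity>\<close>, applied to a function with values in
  \<open>[0,\<infinity>]\<close>. The measure is Lebesgue measure on the Lebesgue measurable sets.\<close>

definition Lq :: "ennreal \<Rightarrow> real set \<Rightarrow> (real \<Rightarrow> ennreal) \<Rightarrow> ennreal" where
  "Lq q I g =
     (if q = \<infinity> then esssup (lebesgue_on I) g
      else ennpowr (\<integral>\<^sup>+ x. ennpowr (g x) (enn2real q) \<partial>lebesgue_on I) (1 / enn2real q))"

text \<open>The weight \<open>u\<^bsup>-\<theta>-1/q\<^esup> a(u)\<close>. The convention \<open>1/\<infinity> = 0\<close> is the one of
  division on \<^typ>\<open>ennreal\<close>.\<close>

definition weight :: "real \<Rightarrow> ennreal \<Rightarrow> (real \<Rightarrow> real) \<Rightarrow> real \<Rightarrow> ennreal" where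
  "weight \<theta> q a u = ennreal (u powr (- \<theta> - enn2real (1 / q)) * a u)"

definition equiv_pos :: "(real \<Rightarrow> real) \<Rightarrow> (real \<Rightarrow> real) \<Rightarrow> bool" where
  "equiv_pos F G \<longleftrightarrow> (\<exists>C>0. \<forall>t>0. G t / C \<le> F t \<and> F t \<le> C * G t)"

definition slowly_varying :: "(real \<Rightarrow> real) \<Rightarrow> bool" where
  "slowly_varying b \<longleftrightarrow>
     (\<forall>t>0. b t > 0) \<and>
     b \<in> borel_measurable (lebesgue_on {0<..}) \<and>
     (\<forall>\<epsilon>>0. (\<exists>\<phi>. mono_on {0<..} \<phi> \<and> equiv_pos (\<lambda>t. t powr \<epsilon> * b t) \<phi>) \<and>
            (\<exists>\<psi>. antimono_on {0<..} \<psi> \<and> equiv_pos (\<lambda>t. t powr (- \<epsilon>) * b t) \<psi>))"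

definition L_norm ::
  "real \<Rightarrow> ennreal \<Rightarrow> (real \<Rightarrow> real) \<Rightarrow> ennreal \<Rightarrow> (real \<Rightarrow> real) \<Rightarrow>
   'v::real_vector qspace \<Rightarrow> 'v qspace \<Rightarrow> 'v \<Rightarrow> ennreal" where
  "L_norm \<theta> r b q a A0 A1 f =
     Lq r {0<..} (\<lambda>t. weight 0 r b t *
       Lq q {0<..<t} (\<lambda>u. weight \<theta> q a u * K_fun (ennreal u) f A0 A1))"

definition L_space ::
  "real \<Rightarrow> ennreal \<Rightarrow> (real \<Rightarrow> real) \<Rightarrow> ennreal \<Rightarrow> (real \<Rightarrow> real) \<Rightarrow>
   'v::real_vector qspace \<Rightarrow> 'v qspace \<Rightarrow> 'v qspace" where
  "L_space \<theta> r b q a A0 A1 =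
     QSpace {f \<in> sum_pts A0 A1. L_norm \<theta> r b q a A0 A1 f < \<infinity>} (L_norm \<theta> r b q a A0 A1)"

definition chi0 :: "ennreal \<Rightarrow> (real \<Rightarrow> real) \<Rightarrow> ennreal \<Rightarrow> (real \<Rightarrow> real) \<Rightarrow> real \<Rightarrow> ennreal" where
  "chi0 r b q a t = Lq r {t<..} (\<lambda>s. weight 0 r b s * Lq q {t<..<s} (weight 0 q a))"

definition chi1 :: "ennreal \<Rightarrow> (real \<Rightarrow> real) \<Rightarrow> ennreal \<Rightarrow> (real \<Rightarrow> real) \<Rightarrow> real \<Rightarrow> ennreal" where
  "chi1 r b q a t =
     Lq r {0<..<t} (\<lambda>s. weight 0 r b s * Lq q {0<..<s} (weight 0 q a)) +
     Lq r {t<..} (weight 0 r b) * Lq q {0<..<t} (weight 0 q a)"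

end

theory Submission
  imports Defs
begin

text \<open>
Both outer spaces are iterated norms of \<open>K(u,f)\<close>, and the only facts about \<open>K(u) = K(u,f)\<close> that
matter are that it is nondecreasing, that \<open>K(u)/u\<close> is nonincreasing, that it is quasi-subadditive in
\<open>f\<close>, and that \<open>f\<close> is split almost optimally at level \<open>t\<close> by some \<open>f = f\<^sub>0 + f\<^sub>1\<close>.

Upper estimate of the outer K-functional. Take such a splitting. Then \<open>K(u,f\<^sub>0)\<close> is controlled by
\<open>K(u,f)\<close> for \<open>u < t\<close> and by the constant \<open>K(t,f)\<close> for \<open>u > t\<close>, while \<open>K(u,f\<^sub>1)\<close> is controlled by
\<open>u K(t,f)/t\<close> for \<open>u < t\<close> and by \<open>K(u,f)\<close> for \<open>u > t\<close>. Cutting both variables of an iterated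
norm at \<open>t\<close> leaves three pieces (\<open>inorm_split\<close>), and the constant parts produce exactly
\<open>\<chi>\<^sub>0(t) K(t,f)\<close> and \<open>\<chi>\<^sub>1(t) K(t,f)/t\<close>. Since \<open>\<rho> \<chi>\<^sub>1 = t \<chi>\<^sub>0\<close>, the sum of the first norm and \<open>\<rho>(t)\<close>
times the second is bounded by the right-hand side up to a factor
(\<open>norm0_le_K_bound\<close>, \<open>norm1_le_K_bound\<close>).

Lower estimate. The right-hand side is quasi-subadditive in \<open>f\<close>, so for an arbitrary decomposition it
suffices to bound it for \<open>f\<^sub>0\<close> by the first norm and for \<open>f\<^sub>1\<close> by \<open>\<rho>(t)\<close> times the second
(\<open>K_bound_le_norm0\<close>, \<open>K_bound_le_norm1\<close>). The terms that are not parts of the norm in question need the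
pointwise bounds \<open>K(u,f) \<le> \<parallel>f\<parallel>\<^sub>0 / \<chi>\<^sub>0(u)\<close> and \<open>K(u,f) \<le> 2 u \<parallel>f\<parallel>\<^sub>1 / \<chi>\<^sub>1(u)\<close>, which are integrated
against the other weight. This works because \<open>\<chi>\<^sub>0\<close> and \<open>\<chi>\<^sub>1\<close> are slowly varying themselves: at the
cost of a factor \<open>(u/t)\<^bsup>1/2\<^esup>\<close> or \<open>(t/u)\<^bsup>1/2\<^esup>\<close> the value at \<open>u\<close> may be replaced by the one at \<open>t\<close>, and the
remaining power of \<open>u\<close> dominates every slowly varying function (\<open>slow_power_tail\<close>, \<open>slow_power_head\<close>).

All norms are taken with respect to \<open>du/u\<close>. This absorbs the factors \<open>u\<^bsup>-1/q\<^esup>\<close>, treats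
\<open>q = \<infinity>\<close> and \<open>q < \<infinity>\<close> alike, and makes the norms invariant under dilations, so that slow variation
of the functions \<open>\<chi>\<^sub>i\<close> is read off by scaling (\<open>slow_on_N\<close>). Inequalities hold in \<open>[0,\<infinity>]\<close> up to finite
factors; dividing by \<open>\<chi>\<^sub>1(t)\<close> is legitimate because \<open>0 < \<chi>\<^sub>1(t) < \<infinity>\<close>.
\<close>

section \<open>Powers of extended non-negative numbers\<close>

lemma ennpowr_top [simp]: "ennpowr top p = top"
  by (simp add: ennpowr_def)

lemma ennpowr_zero [simp]: "ennpowr 0 p = 0"
  by (simp add: ennpowr_def)

lemma ennpowr_ennreal: "0 \<le> x \<Longrightarrow> ennpowr (ennreal x) p = ennreal (x powr p)"
  by (simp add: ennpowr_def)

lemma ennpowr_one [simp]: "ennpowr 1 p = 1"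
  using ennpowr_ennreal[of 1 p] by simp

lemma ennpowr_eq_0_iff: "ennpowr x p = 0 \<longleftrightarrow> x = 0"
  by (cases x) (auto simp: ennpowr_ennreal)

lemma ennpowr_less_top_iff: "ennpowr x p < top \<longleftrightarrow> x < top"
  by (cases x) (auto simp: ennpowr_ennreal)

lemma ennpowr_mono: "0 < p \<Longrightarrow> x \<le> y \<Longrightarrow> ennpowr x p \<le> ennpowr y p"
  by (cases x; cases y) (auto simp: ennpowr_ennreal top_unique intro!: ennreal_leI powr_mono2)

lemma ennpowr_mult: "0 < p \<Longrightarrow> ennpowr (x * y) p = ennpowr x p * ennpowr y p"
  by (cases x; cases y)
    (auto simp: ennpowr_ennreal ennreal_mult_top ennreal_top_mult powr_mult ennreal_mult''
      simp flip: ennreal_mult'')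

lemma ennpowr_ennpowr_inverse: "0 < p \<Longrightarrow> ennpowr (ennpowr x p) (1 / p) = x"
  by (cases x) (auto simp: ennpowr_ennreal powr_powr)

lemma ennpowr_add_le:
  assumes "0 < p"
  shows "ennpowr (x + y) p \<le> ennpowr 2 p * (ennpowr x p + ennpowr y p)"
proof -
  have "x + y \<le> 2 * max x y"
    by (simp add: mult_2 add_mono)
  then have "ennpowr (x + y) p \<le> ennpowr 2 p * ennpowr (max x y) p"
    using ennpowr_mono[OF assms] ennpowr_mult[OF assms] by metis
  also have "ennpowr (max x y) p \<le> ennpowr x p + ennpowr y p"
    by (simp add: max_def)
  finally show ?thesis
    by (meson dual_order.trans le_refl mult_left_mono zero_le)
qed

lemma ennpowr_measurable [measurable]: "(\<lambda>x. ennpowr x p) \<in> borel_measurable borel"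
  unfolding ennpowr_def by measurable

section \<open>The quasi-norms of Lebesgue spaces\<close>

text \<open>The same formula as for \<open>Lq\<close>, but over an arbitrary measure space, so that it applies to \<open>du/u\<close>.\<close>
definition Lp_norm :: "'a measure \<Rightarrow> ennreal \<Rightarrow> ('a \<Rightarrow> ennreal) \<Rightarrow> ennreal" where
  "Lp_norm M q g =
     (if q = \<infinity> then esssup M g
      else ennpowr (\<integral>\<^sup>+ x. ennpowr (g x) (enn2real q) \<partial>M) (1 / enn2real q))"

lemma Lp_norm_mono:
  assumes q: "0 < q" and g: "g \<in> borel_measurable M" and le: "AE x in M. g x \<le> h x"
  shows "Lp_norm M q g \<le> Lp_norm M q h"
proof (cases "q = \<infinity>")
  case True
  then show ?thesis by (simp add: Lp_norm_def esssup_AE_mono g le)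
next
  case False
  then have p: "0 < enn2real q"
    using q by (simp add: enn2real_positive_iff top.not_eq_extremum)
  then show ?thesis
    using False le
    by (auto simp: Lp_norm_def intro!: ennpowr_mono nn_integral_mono_AE elim!: eventually_mono)
qed

text \<open>The infinite factor is included: weights and norms may be infinite, and \<open>\<infinity> \<cdot> 0 = 0\<close> is
  consistent with null functions having norm \<open>0\<close>.\<close>
lemma esssup_cmult_ennreal:
  fixes g :: "'a \<Rightarrow> ennreal"
  assumes g [measurable]: "g \<in> borel_measurable M"
  shows "esssup M (\<lambda>x. c * g x) = c * esssup M g"
proof (rule antisym)
  show "esssup M (\<lambda>x. c * g x) \<le> c * esssup M g"
    by (rule esssup_I) (use esssup_AE[of g M] in \<open>auto elim!: eventually_mono intro: mult_left_mono\<close>)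
  have *: "AE x in M. c * g x \<le> esssup M (\<lambda>x. c * g x)"
    by (rule esssup_AE)
  show "c * esssup M g \<le> esssup M (\<lambda>x. c * g x)" (is "_ \<le> ?s")
  proof (cases "c = 0 \<or> ?s = top")
    case False
    show ?thesis
    proof (cases "c = top")
      case True
      have "esssup M g \<le> 0"
        by (rule esssup_I[OF g])
          (use * False True in \<open>auto elim!: eventually_mono simp: ennreal_top_mult top_unique split: if_splits\<close>)
      then show ?thesis by simp
    next
      case ctop: False
      have "esssup M g \<le> ?s / c"
      proof (rule esssup_I[OF g], use * in eventually_elim)
        fix x assume "c * g x \<le> ?s"
        then have "c * g x / c \<le> ?s / c" by (rule divide_right_mono_ennreal)
        then show "g x \<le> ?s / c"
          using False ctop by (simp add: mult.commute[of c] mult_divide_eq_ennreal)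
      qed
      then have "c * esssup M g \<le> c * (?s / c)" by (rule mult_left_mono) simp
      also have "\<dots> = ?s"
        using False ctop by (simp add: ennreal_times_divide mult.commute[of c] mult_divide_eq_ennreal)
      finally show ?thesis .
    qed
  qed auto
qed

lemma Lp_norm_cmult:
  assumes q: "0 < q" and g [measurable]: "g \<in> borel_measurable M"
  shows "Lp_norm M q (\<lambda>x. c * g x) = c * Lp_norm M q g"
proof (cases "q = \<infinity>")
  case True
  then show ?thesis by (simp add: Lp_norm_def esssup_cmult_ennreal)
next
  case False
  then have p: "0 < enn2real q"
    using q by (simp add: enn2real_positive_iff top.not_eq_extremum)
  show ?thesis
    using False p by (simp add: Lp_norm_def ennpowr_mult nn_integral_cmult ennpowr_ennpowr_inverse)
qed

text \<open>From \<open>x + y \<le> 2 max x y\<close>, which settles all exponents at once. The constant has to be uniform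
  in the functions, since the estimates below apply this to families of functions.\<close>
lemma Lp_norm_add:
  assumes q: "0 < q"
  shows "\<exists>C<top. \<forall>M. \<forall>g \<in> borel_measurable M. \<forall>h \<in> borel_measurable M.
    Lp_norm M q (\<lambda>x. g x + h x) \<le> C * (Lp_norm M q g + Lp_norm M q h)"
proof (cases "q = \<infinity>")
  case True
  have "esssup M (\<lambda>x. g x + h x) \<le> esssup M g + esssup M h"
    if [measurable]: "g \<in> borel_measurable M" "h \<in> borel_measurable M"
    for M :: "'a measure" and g h :: "'a \<Rightarrow> ennreal"
    by (rule esssup_I, measurable)
      (use esssup_AE[of g M] esssup_AE[of h M] in \<open>eventually_elim, auto intro: add_mono\<close>)
  then show ?thesis
    using True by (intro exI[of _ 1]) (auto simp: Lp_norm_def)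
next
  case False
  define p where "p = enn2real q"
  have p: "0 < p"
    using False q by (simp add: p_def enn2real_positive_iff top.not_eq_extremum)
  define C where "C = 2 * ennpowr 2 (1 / p)"
  have "Lp_norm M q (\<lambda>x. g x + h x) \<le> C * (Lp_norm M q g + Lp_norm M q h)"
    if [measurable]: "g \<in> borel_measurable M" "h \<in> borel_measurable M"
    for M :: "'a measure" and g h :: "'a \<Rightarrow> ennreal"
  proof -
    let ?I = "\<lambda>g. \<integral>\<^sup>+ x. ennpowr (g x) p \<partial>M"
    have "?I (\<lambda>x. g x + h x) \<le> (\<integral>\<^sup>+ x. ennpowr 2 p * (ennpowr (g x) p + ennpowr (h x) p) \<partial>M)"
      by (intro nn_integral_mono ennpowr_add_le p)
    also have "\<dots> = ennpowr 2 p * (?I g + ?I h)"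
      by (simp add: nn_integral_cmult nn_integral_add)
    finally have "ennpowr (?I (\<lambda>x. g x + h x)) (1 / p) \<le> ennpowr \<dots> (1 / p)"
      using p by (intro ennpowr_mono) auto
    also have "\<dots> = 2 * ennpowr (?I g + ?I h) (1 / p)"
      using p by (simp add: ennpowr_mult ennpowr_ennpowr_inverse)
    also have "\<dots> \<le> 2 * (ennpowr 2 (1 / p) * (ennpowr (?I g) (1 / p) + ennpowr (?I h) (1 / p)))"
      using p by (intro mult_left_mono ennpowr_add_le) auto
    finally show ?thesis
      using False by (simp add: Lp_norm_def p_def C_def mult.assoc)
  qed
  moreover have "C < top"
    by (auto simp: C_def ennreal_mult_less_top ennpowr_less_top_iff)
  ultimately show ?thesis by blast
qed

lemma Lp_norm_eq_0:
  assumes q: "0 < q" and g [measurable]: "g \<in> borel_measurable M" and 0: "Lp_norm M q g = 0"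
  shows "AE x in M. g x = 0"
proof (cases "q = \<infinity>")
  case True
  then show ?thesis using 0 esssup_AE[of g M] by (simp add: Lp_norm_def)
next
  case False
  then show ?thesis using 0 by (simp add: Lp_norm_def ennpowr_eq_0_iff nn_integral_0_iff_AE)
qed

section \<open>The multiplication-invariant measure on the half-line\<close>

text \<open>The measure \<open>du/u\<close>, the Haar measure of the multiplicative group of positive numbers.\<close>
definition dlog :: "real measure" where
  "dlog = density (lebesgue_on {0<..}) (\<lambda>u. ennreal (1 / u))"

lemma sets_dlog [measurable_cong]: "sets dlog = sets (lebesgue_on {0<..})"
  by (simp add: dlog_def)

lemma space_dlog [simp]: "space dlog = {0<..}"
  by (simp add: dlog_def)

lemma ident_measurable_dlog [measurable]: "(\<lambda>u. u) \<in> borel_measurable dlog"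
  unfolding measurable_cong_sets[OF sets_dlog refl]
  by (rule measurable_restrict_space1, rule measurable_completion) simp

lemma borel_measurable_dlog_iff: "g \<in> borel_measurable dlog \<longleftrightarrow> g \<in> borel_measurable (lebesgue_on {0<..})"
  by (simp add: measurable_cong_sets[OF sets_dlog refl])

lemma one_over_measurable: "(\<lambda>u::real. ennreal (1 / u)) \<in> borel_measurable (lebesgue_on {0<..})"
  unfolding borel_measurable_dlog_iff[symmetric] by measurable

lemma AE_dlog_iff: "(AE u in dlog. P u) \<longleftrightarrow> (AE u in lebesgue. 0 < u \<longrightarrow> P u)"
proof -
  have "(AE u in dlog. P u) \<longleftrightarrow> (AE u in lebesgue_on {0<..}. 0 < ennreal (1 / u) \<longrightarrow> P u)"
    unfolding dlog_def by (rule AE_density[OF one_over_measurable])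
  also have "\<dots> \<longleftrightarrow> (AE u in lebesgue. u \<in> {0<..} \<longrightarrow> 0 < ennreal (1 / u) \<longrightarrow> P u)"
    by (rule AE_restrict_space_iff) simp
  finally show ?thesis
    by (simp add: ennreal_less_zero_iff)
qed

lemma nn_integral_dlog:
  assumes "g \<in> borel_measurable dlog"
  shows "(\<integral>\<^sup>+ u. g u \<partial>dlog) = (\<integral>\<^sup>+ u. ennreal (1 / u) * g u * indicator {0<..} u \<partial>lebesgue)"
proof -
  have "(\<integral>\<^sup>+ u. g u \<partial>dlog) = (\<integral>\<^sup>+ u. ennreal (1 / u) * g u \<partial>lebesgue_on {0<..})"
    unfolding dlog_def
    by (rule nn_integral_density) (use assms one_over_measurable in \<open>auto simp: borel_measurable_dlog_iff\<close>)
  also have "\<dots> = (\<integral>\<^sup>+ u. ennreal (1 / u) * g u * indicator {0<..} u \<partial>lebesgue)"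
    by (rule nn_integral_restrict_space) simp
  finally show ?thesis .
qed

lemma scale_measurable_lebesgue: "(\<lambda>u::real. c * u) \<in> measurable lebesgue lebesgue"
proof -
  have "(\<lambda>u::real. c * u) = (*\<^sub>R) c" by (simp add: fun_eq_iff)
  then show ?thesis using lebesgue_measurable_scaling by metis
qed

lemma scale_measurable_dlog [measurable]:
  assumes c: "0 < c"
  shows "(\<lambda>u. c * u) \<in> measurable dlog dlog"
proof -
  have "(\<lambda>u. c * u) \<in> measurable (lebesgue_on {0<..}) (lebesgue_on {0<..})"
    by (intro measurable_restrict_space2 measurable_restrict_space1 scale_measurable_lebesgue)
      (use c in auto)
  then show ?thesis
    by (simp add: measurable_cong_sets[OF sets_dlog sets_dlog])
qed

text \<open>The density \<open>1/u\<close> absorbs the factor by which a dilation changes Lebesgue measure.\<close>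
lemma distr_scale_dlog:
  assumes c: "0 < c"
  shows "distr dlog dlog (\<lambda>u. c * u) = dlog"
proof (rule measure_eqI)
  note [measurable] = scale_measurable_dlog[OF c]
  fix A assume "A \<in> sets (distr dlog dlog (\<lambda>u. c * u))"
  then have A [measurable]: "A \<in> sets dlog" by simp
  define h :: "real \<Rightarrow> ennreal" where "h u = ennreal (1 / u) * indicator A u * indicator {0<..} u" for u
  have h: "h \<in> borel_measurable lebesgue"
  proof -
    have "(\<lambda>u. ennreal (1 / u) * indicator A u) \<in> borel_measurable dlog" by measurable
    then show ?thesis
      unfolding h_def borel_measurable_dlog_iff by (subst (asm) borel_measurable_restrict_space_iff_ennreal) auto
  qed
  have "emeasure (distr dlog dlog (\<lambda>u. c * u)) A = (\<integral>\<^sup>+ u. indicator A (c * u) \<partial>dlog)"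
    by (subst nn_integral_indicator[symmetric], simp, subst nn_integral_distr) auto
  also have "\<dots> = (\<integral>\<^sup>+ u. ennreal c * h (c * u) \<partial>lebesgue)"
    by (subst nn_integral_dlog, measurable, intro nn_integral_cong)
      (use c in \<open>auto simp: h_def ennreal_mult''[symmetric] zero_less_mult_iff split: split_indicator\<close>)
  also have "\<dots> = (\<integral>\<^sup>+ u. h u \<partial>density (distr lebesgue lebesgue (\<lambda>x. c * x)) (\<lambda>x. ennreal \<bar>c\<bar>))"
    using c by (subst nn_integral_density) (use h scale_measurable_lebesgue in \<open>auto simp: nn_integral_distr\<close>)
  also have "\<dots> = (\<integral>\<^sup>+ u. h u \<partial>lebesgue)"
    using lebesgue_real_scale[of c] c by simp
  also have "\<dots> = emeasure dlog A"
    by (simp add: h_def flip: nn_integral_dlog)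
  finally show "emeasure (distr dlog dlog (\<lambda>u. c * u)) A = emeasure dlog A" .
qed simp

abbreviation N :: "ennreal \<Rightarrow> (real \<Rightarrow> ennreal) \<Rightarrow> ennreal" where
  "N \<equiv> Lp_norm dlog"

lemma N_scale:
  assumes c: "0 < c" and g [measurable]: "g \<in> borel_measurable dlog"
  shows "N q (\<lambda>u. g (c * u)) = N q g"
proof -
  note [measurable] = scale_measurable_dlog[OF c]
  have "N q (\<lambda>u. g (c * u)) = Lp_norm (distr dlog dlog (\<lambda>u. c * u)) q g"
  proof (cases "q = \<infinity>")
    case True
    have *: "{u \<in> space dlog. g u \<le> z} \<in> sets dlog" for z
      by measurable
    have "(AE u in dlog. g (c * u) \<le> z) \<longleftrightarrow> (AE u in distr dlog dlog (\<lambda>u. c * u). g u \<le> z)" for z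
      by (rule AE_distr_iff[OF scale_measurable_dlog[OF c] *, symmetric])
    then show ?thesis
      using True by (simp add: Lp_norm_def esssup_eq_AE)
  next
    case False
    then show ?thesis by (simp add: Lp_norm_def nn_integral_distr)
  qed
  then show ?thesis by (simp add: distr_scale_dlog[OF c])
qed

text \<open>The factor \<open>u\<^bsup>-1/q\<^esup>\<close> becomes the density of \<open>du/u\<close> after raising to the power \<open>q\<close>; for
  \<open>q = \<infinity>\<close> it is \<open>1\<close>, and only the null sets matter.\<close>
lemma Lq_eq_N:
  assumes q: "0 < q" and I: "I \<subseteq> {0<..}" "I \<in> sets lebesgue"
    and g [measurable]: "g \<in> borel_measurable dlog"
    and w: "\<And>u. u \<in> I \<Longrightarrow> w u = ennreal (u powr (- enn2real (1 / q))) * g u"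
  shows "Lq q I w = N q (\<lambda>u. indicator I u * g u)"
proof -
  have I' [measurable]: "I \<in> sets dlog"
    unfolding sets_dlog using I by (subst sets_restrict_space_iff) auto
  show ?thesis
  proof (cases "q = \<infinity>")
    case True
    have wg: "\<And>u. u \<in> I \<Longrightarrow> w u = g u"
      using I(1) by (auto simp: w True subset_iff)
    have "(\<lambda>u. g u * indicator I u) \<in> borel_measurable lebesgue"
    proof -
      have "(\<lambda>u. (g u * indicator I u) * indicator {0<..} u) \<in> borel_measurable lebesgue"
        by (subst borel_measurable_restrict_space_iff_ennreal[symmetric])
          (auto simp flip: borel_measurable_dlog_iff)
      also have "(\<lambda>u. (g u * indicator I u) * indicator {0<..} u) = (\<lambda>u. g u * indicator I u)"
        using I(1) by (auto simp: fun_eq_iff subset_iff split: split_indicator)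
      finally show ?thesis .
    qed
    then have gI: "g \<in> borel_measurable (lebesgue_on I)"
      by (subst borel_measurable_restrict_space_iff_ennreal) (use I in auto)
    have wI: "w \<in> borel_measurable (lebesgue_on I)"
      using gI by (subst measurable_cong[where g = g]) (use wg in auto)
    have "(AE u in lebesgue_on I. w u \<le> z) \<longleftrightarrow> (AE u in dlog. indicator I u * g u \<le> z)" for z
    proof -
      have "(AE u in lebesgue_on I. w u \<le> z) \<longleftrightarrow> (AE u in lebesgue. u \<in> I \<longrightarrow> w u \<le> z)"
        using I by (intro AE_restrict_space_iff) auto
      also have "\<dots> \<longleftrightarrow> (AE u in lebesgue. 0 < u \<longrightarrow> indicator I u * g u \<le> z)"
        by (rule AE_cong) (use I(1) wg in \<open>auto split: split_indicator\<close>)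
      finally show ?thesis by (simp add: AE_dlog_iff)
    qed
    then show ?thesis
      using True wI by (simp add: Lq_def Lp_norm_def esssup_eq_AE)
  next
    case False
    define p where "p = enn2real q"
    have p: "0 < p"
      using False q by (simp add: p_def enn2real_positive_iff top.not_eq_extremum)
    have q': "enn2real (1 / q) = 1 / p"
    proof -
      have "q = ennreal p" using False by (simp add: p_def top.not_eq_extremum)
      then show ?thesis using p by (metis divide_ennreal enn2real_ennreal ennreal_1 less_eq_real_def zero_le_divide_1_iff zero_le_one)
    qed
    have "(\<integral>\<^sup>+ u. ennpowr (w u) p \<partial>lebesgue_on I) = (\<integral>\<^sup>+ u. ennpowr (w u) p * indicator I u \<partial>lebesgue)"
      using I by (intro nn_integral_restrict_space) auto
    also have "\<dots> = (\<integral>\<^sup>+ u. ennreal (1 / u) * ennpowr (indicator I u * g u) p * indicator {0<..} u \<partial>lebesgue)"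
    proof (rule nn_integral_cong)
      fix u :: real
      show "ennpowr (w u) p * indicator I u =
        ennreal (1 / u) * ennpowr (indicator I u * g u) p * indicator {0<..} u"
      proof (cases "u \<in> I")
        case True
        then have "0 < u" using I by auto
        have "(u powr (- (1 / p))) powr p = u powr (- 1)"
          using p by (simp only: powr_powr) simp
        then have "(u powr (- (1 / p))) powr p = 1 / u"
          using \<open>0 < u\<close> by (simp add: powr_minus_divide)
        then show ?thesis
          using True p \<open>0 < u\<close> by (simp add: w q' ennpowr_mult ennpowr_ennreal)
      qed auto
    qed
    also have "\<dots> = (\<integral>\<^sup>+ u. ennpowr (indicator I u * g u) p \<partial>dlog)"
      by (subst nn_integral_dlog) auto
    finally show ?thesis
      using False by (simp add: Lq_def Lp_norm_def p_def)
  qed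
qed

lemma N_le_cmult:
  assumes q: "0 < q" and m: "f \<in> borel_measurable dlog" "g \<in> borel_measurable dlog"
    and le: "\<And>u. 0 < u \<Longrightarrow> f u \<le> c * g u"
  shows "N q f \<le> c * N q g"
proof -
  have "N q f \<le> N q (\<lambda>u. c * g u)"
    by (rule Lp_norm_mono[OF q m(1)]) (use le in \<open>auto intro!: AE_I2\<close>)
  also have "\<dots> = c * N q g" by (rule Lp_norm_cmult[OF q m(2)])
  finally show ?thesis .
qed

lemma N_mono:
  assumes q: "0 < q" and m: "f \<in> borel_measurable dlog"
    and le: "\<And>u. 0 < u \<Longrightarrow> f u \<le> g u"
  shows "N q f \<le> N q g"
  by (rule Lp_norm_mono[OF q m(1)]) (use le in \<open>auto intro!: AE_I2\<close>)

lemma mono_on_measurable_dlog: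
  fixes f :: "real \<Rightarrow> ennreal"
  assumes mono: "\<And>x y. 0 < x \<Longrightarrow> x \<le> y \<Longrightarrow> f x \<le> f y"
  shows "f \<in> borel_measurable dlog"
proof (rule borel_measurableI_le)
  fix y
  have "is_interval {x \<in> space dlog. f x \<le> y}"
    unfolding is_interval_1 by (auto intro: order_trans[OF mono])
  then have "{x \<in> space dlog. f x \<le> y} \<in> sets borel"
    by (rule real_interval_borel_measurable)
  then have "{x \<in> space dlog. f x \<le> y} \<in> sets lebesgue"
    by (simp add: sets_completionI_sets)
  then show "{x \<in> space dlog. f x \<le> y} \<in> sets dlog"
    unfolding sets_dlog by (subst sets_restrict_space_iff) auto
qed

lemma inner_measurable [measurable]:
  assumes q: "0 < q" and g [measurable]: "g \<in> borel_measurable dlog"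
  shows "(\<lambda>s. N q (\<lambda>u. indicator {x<..<s} u * g u)) \<in> borel_measurable dlog"
  by (rule mono_on_measurable_dlog, rule N_mono[OF q])
    (measurable, auto split: split_indicator)

lemma power_tail_finite:
  assumes q: "0 < q" and d: "0 < \<delta>"
  shows "N q (\<lambda>u. indicator {1<..} u * ennreal (u powr (- \<delta>))) < top"
proof (cases "q = \<infinity>")
  case True
  have "N q (\<lambda>u. indicator {1<..} u * ennreal (u powr (- \<delta>))) \<le> 1"
    unfolding Lp_norm_def if_P[OF True]
    using d by (intro esssup_I)
      (auto intro!: AE_I2 simp: powr_minus_divide ge_one_powr_ge_zero ennreal_le_1 split: split_indicator)
  then show ?thesis by (rule le_less_trans) simp
next
  case False
  define p where "p = enn2real q"
  have p: "0 < p"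
    using False q by (simp add: p_def enn2real_positive_iff top.not_eq_extremum)
  have "(\<integral>\<^sup>+ u. ennpowr (indicator {1<..} u * ennreal (u powr (- \<delta>))) p \<partial>dlog)
     \<le> (\<integral>\<^sup>+ u. ennreal (u powr (- \<delta> * p - 1)) * indicator {1..} u \<partial>lebesgue)"
    by (subst nn_integral_dlog, measurable, intro nn_integral_mono)
      (use p in \<open>auto simp: ennpowr_mult ennpowr_ennreal powr_powr powr_diff ennreal_mult''[symmetric] split: split_indicator\<close>)
  also have "\<dots> < top"
    by (subst nn_integral_completion, subst nn_integral_has_integral_lebesgue'[OF _ has_integral_powr_to_inf]) (use p d in auto)
  finally show ?thesis
    using False by (simp add: Lp_norm_def p_def ennpowr_less_top_iff)
qed

lemma power_head_finite:
  assumes q: "0 < q" and d: "0 < \<delta>"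
  shows "N q (\<lambda>u. indicator {0<..<1} u * ennreal (u powr \<delta>)) < top"
proof (cases "q = \<infinity>")
  case True
  have "N q (\<lambda>u. indicator {0<..<1} u * ennreal (u powr \<delta>)) \<le> 1"
    unfolding Lp_norm_def if_P[OF True]
    using d by (intro esssup_I) (auto intro!: AE_I2 powr_le1 simp: ennreal_le_1 split: split_indicator)
  then show ?thesis by (rule le_less_trans) simp
next
  case False
  define p where "p = enn2real q"
  have p: "0 < p"
    using False q by (simp add: p_def enn2real_positive_iff top.not_eq_extremum)
  have "(\<integral>\<^sup>+ u. ennpowr (indicator {0<..<1} u * ennreal (u powr \<delta>)) p \<partial>dlog)
     \<le> (\<integral>\<^sup>+ u. ennreal (u powr (\<delta> * p - 1)) * indicator {0..1} u \<partial>lebesgue)"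
    by (subst nn_integral_dlog, measurable, intro nn_integral_mono)
      (use p in \<open>auto simp: ennpowr_mult ennpowr_ennreal powr_powr powr_diff ennreal_mult''[symmetric] split: split_indicator\<close>)
  also have "\<dots> < top"
    by (subst nn_integral_completion, subst nn_integral_has_integral_lebesgue'[OF _ has_integral_powr_from_0]) (use p d in auto)
  finally show ?thesis
    using False by (simp add: Lp_norm_def p_def ennpowr_less_top_iff)
qed

text \<open>By dilation invariance the case \<open>t = 1\<close> suffices, and there the integral is explicit.\<close>
lemma power_tail:
  assumes q: "0 < q" and d: "0 < \<delta>"
  shows "\<exists>C<top. \<forall>t>0. N q (\<lambda>u. indicator {t<..} u * ennreal (u powr (- \<delta>))) \<le> C * ennreal (t powr (- \<delta>))"
proof -
  have "N q (\<lambda>u. indicator {t<..} u * ennreal (u powr (- \<delta>)))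
      \<le> N q (\<lambda>u. indicator {1<..} u * ennreal (u powr (- \<delta>))) * ennreal (t powr (- \<delta>))" if t: "0 < t" for t
  proof -
    have "N q (\<lambda>u. indicator {t<..} u * ennreal (u powr (- \<delta>)))
        = N q (\<lambda>u. indicator {t<..} (t * u) * ennreal ((t * u) powr (- \<delta>)))"
      by (rule N_scale[symmetric, OF t]) measurable
    also have "\<dots> \<le> ennreal (t powr (- \<delta>)) * N q (\<lambda>u. indicator {1<..} u * ennreal (u powr (- \<delta>)))"
      by (rule N_le_cmult[OF q], measurable)
        (use t in \<open>auto simp: powr_mult ennreal_mult'' split: split_indicator\<close>)
    finally show ?thesis by (simp add: mult.commute)
  qed
  then show ?thesis using power_tail_finite[OF q d] by blast
qed

lemma power_head:
  assumes q: "0 < q" and d: "0 < \<delta>"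
  shows "\<exists>C<top. \<forall>t>0. N q (\<lambda>u. indicator {0<..<t} u * ennreal (u powr \<delta>)) \<le> C * ennreal (t powr \<delta>)"
proof -
  have "N q (\<lambda>u. indicator {0<..<t} u * ennreal (u powr \<delta>))
      \<le> N q (\<lambda>u. indicator {0<..<1} u * ennreal (u powr \<delta>)) * ennreal (t powr \<delta>)" if t: "0 < t" for t
  proof -
    have "N q (\<lambda>u. indicator {0<..<t} u * ennreal (u powr \<delta>))
        = N q (\<lambda>u. indicator {0<..<t} (t * u) * ennreal ((t * u) powr \<delta>))"
      by (rule N_scale[symmetric, OF t]) measurable
    also have "\<dots> \<le> ennreal (t powr \<delta>) * N q (\<lambda>u. indicator {0<..<1} u * ennreal (u powr \<delta>))"
      by (rule N_le_cmult[OF q], measurable)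
        (use t in \<open>auto simp: powr_mult ennreal_mult'' split: split_indicator\<close>)
    finally show ?thesis by (simp add: mult.commute)
  qed
  then show ?thesis using power_head_finite[OF q d] by blast
qed

lemma N_dyadic:
  assumes q: "0 < q"
  shows "0 < N q (indicator {1<..<2})" "N q (indicator {1<..<2}) < top"
proof -
  have "N q (indicator {1<..<2}) \<noteq> 0"
  proof
    assume "N q (indicator {1<..<2}) = 0"
    then have "AE u in dlog. indicator {1<..<2} u = (0::ennreal)"
      by (intro Lp_norm_eq_0[OF q]) measurable
    then have "AE u in lebesgue. u \<notin> {1<..<2::real}"
      unfolding AE_dlog_iff by eventually_elim (auto split: split_indicator_asm)
    then have "{1<..<2::real} \<in> null_sets lebesgue"
      by (subst AE_iff_null_sets) auto
    then show False by (simp add: null_sets_def)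
  qed
  then show "0 < N q (indicator {1<..<2})" by (simp add: zero_less_iff_neq_zero)
  have "N q (indicator {1<..<2}) \<le> 2 * N q (\<lambda>u. indicator {1<..} u * ennreal (u powr (- 1)))"
  proof (rule N_le_cmult[OF q], measurable)
    fix u :: real assume "0 < u"
    have "1 \<le> 2 * ennreal (1 / u)" if "1 < u" "u < 2"
    proof -
      have "ennreal (2 * (1 / u)) = 2 * ennreal (1 / u)"
        using that by (subst ennreal_mult'') auto
      moreover have "1 \<le> ennreal (2 * (1 / u))" using that by simp
      ultimately show ?thesis by simp
    qed
    then show "indicator {1<..<2} u \<le> 2 * (indicator {1<..} u * ennreal (u powr - 1))"
      using \<open>0 < u\<close> by (auto simp: powr_minus_divide split: split_indicator)
  qed
  also have "\<dots> < top"
    using power_tail_finite[OF q, of 1] by (simp add: ennreal_mult_less_top)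
  finally show "N q (indicator {1<..<2}) < top" .
qed

section \<open>Slow variation\<close>

text \<open>Slow variation in a dilation form that makes sense for functions of several variables. Here
  \<open>P\<close> is a cone, and the extra variables are needed because the inner norm in \<open>\<chi>\<^sub>0\<close> depends on
  both endpoints.\<close>
definition slow_on :: "'a::real_vector set \<Rightarrow> ('a \<Rightarrow> ennreal) \<Rightarrow> bool" where
  "slow_on P F \<longleftrightarrow> (\<forall>\<epsilon>>0. \<exists>C<top. \<forall>c\<ge>1. \<forall>p\<in>P.
     F (c *\<^sub>R p) \<le> C * ennreal (c powr \<epsilon>) * F p \<and> F p \<le> C * ennreal (c powr \<epsilon>) * F (c *\<^sub>R p))"

lemma slow_onD:
  assumes "slow_on P F" "0 < \<epsilon>"
  obtains C where "C < top"
    "\<And>c p. 1 \<le> c \<Longrightarrow> p \<in> P \<Longrightarrow> F (c *\<^sub>R p) \<le> C * ennreal (c powr \<epsilon>) * F p"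
    "\<And>c p. 1 \<le> c \<Longrightarrow> p \<in> P \<Longrightarrow> F p \<le> C * ennreal (c powr \<epsilon>) * F (c *\<^sub>R p)"
  using assms unfolding slow_on_def by blast

lemma slow_onI:
  assumes "\<And>\<epsilon>. 0 < \<epsilon> \<Longrightarrow> \<exists>C<top. \<forall>c\<ge>1. \<forall>p\<in>P.
     F (c *\<^sub>R p) \<le> C * ennreal (c powr \<epsilon>) * F p \<and> F p \<le> C * ennreal (c powr \<epsilon>) * F (c *\<^sub>R p)"
  shows "slow_on P F"
  using assms unfolding slow_on_def by blast

text \<open>The almost increasing \<open>t\<^bsup>\<epsilon>\<^esup> b(t)\<close> bounds \<open>b(u)\<close> by \<open>b(cu)\<close>, and the almost decreasing
  \<open>t\<^bsup>-\<epsilon>\<^esup> b(t)\<close> bounds \<open>b(cu)\<close> by \<open>b(u)\<close>.\<close>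
lemma slow_on_slowly_varying:
  assumes "slowly_varying b"
  shows "slow_on {0<..} (\<lambda>u. ennreal (b u))"
proof (rule slow_onI)
  fix \<epsilon> :: real assume e: "0 < \<epsilon>"
  have pos: "0 < b u" if "0 < u" for u using assms that by (auto simp: slowly_varying_def)
  have "(\<exists>\<phi>. mono_on {0<..} \<phi> \<and> equiv_pos (\<lambda>t. t powr \<epsilon> * b t) \<phi>) \<and>
      (\<exists>\<psi>. antimono_on {0<..} \<psi> \<and> equiv_pos (\<lambda>t. t powr (- \<epsilon>) * b t) \<psi>)"
    using assms e unfolding slowly_varying_def by blast
  then obtain \<phi> \<psi> where \<phi>: "mono_on {0<..} \<phi>" "equiv_pos (\<lambda>t. t powr \<epsilon> * b t) \<phi>"
      and \<psi>: "antimono_on {0<..} \<psi>" "equiv_pos (\<lambda>t. t powr (- \<epsilon>) * b t) \<psi>"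
    by blast
  obtain C where C: "C > 0"
      "\<And>t. t > 0 \<Longrightarrow> \<phi> t / C \<le> t powr \<epsilon> * b t \<and> t powr \<epsilon> * b t \<le> C * \<phi> t"
    using \<phi>(2) unfolding equiv_pos_def by blast
  obtain D where D: "D > 0"
      "\<And>t. t > 0 \<Longrightarrow> \<psi> t / D \<le> t powr (- \<epsilon>) * b t \<and> t powr (- \<epsilon>) * b t \<le> D * \<psi> t"
    using \<psi>(2) unfolding equiv_pos_def by blast
  have "b (c * u) \<le> (C\<^sup>2 + D\<^sup>2) * c powr \<epsilon> * b u \<and> b u \<le> (C\<^sup>2 + D\<^sup>2) * c powr \<epsilon> * b (c * u)"
    if c: "1 \<le> c" and u: "0 < u" for c u
  proof
    have cu: "0 < c * u" "u \<le> c * u" using c u by auto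
    have "u powr \<epsilon> * b u \<le> C * \<phi> u" using C u by auto
    also have "\<dots> \<le> C * \<phi> (c * u)"
      using C(1) \<phi>(1) u cu by (intro mult_left_mono) (auto simp: monotone_on_def)
    also have "\<dots> \<le> C * (C * ((c * u) powr \<epsilon> * b (c * u)))"
      using C(1) C(2)[OF cu(1)] by (intro mult_left_mono) (auto simp: field_simps)
    also have "\<dots> = C\<^sup>2 * (c powr \<epsilon> * u powr \<epsilon> * b (c * u))"
      using c u by (simp add: powr_mult power2_eq_square)
    finally have "u powr \<epsilon> * b u \<le> u powr \<epsilon> * (C\<^sup>2 * c powr \<epsilon> * b (c * u))"
      by (simp add: algebra_simps)
    then have "b u \<le> C\<^sup>2 * c powr \<epsilon> * b (c * u)"
      using u by (simp only: mult_le_cancel_left_pos powr_gt_zero)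
    also have "\<dots> \<le> (C\<^sup>2 + D\<^sup>2) * c powr \<epsilon> * b (c * u)"
      using pos[OF cu(1)] by (intro mult_right_mono) auto
    finally show "b u \<le> (C\<^sup>2 + D\<^sup>2) * c powr \<epsilon> * b (c * u)" .
    have "(c * u) powr (- \<epsilon>) * b (c * u) \<le> D * \<psi> (c * u)" using D cu by auto
    also have "\<dots> \<le> D * \<psi> u"
      using D(1) \<psi>(1) u cu by (intro mult_left_mono) (auto simp: monotone_on_def)
    also have "\<dots> \<le> D * (D * (u powr (- \<epsilon>) * b u))"
      using D(1) D(2)[OF u] by (intro mult_left_mono) (auto simp: field_simps)
    finally have "(c * u) powr (- \<epsilon>) * b (c * u) \<le> D\<^sup>2 * (u powr (- \<epsilon>) * b u)"
      by (simp add: power2_eq_square)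
    then have "(c * u) powr \<epsilon> * ((c * u) powr (- \<epsilon>) * b (c * u)) \<le> (c * u) powr \<epsilon> * (D\<^sup>2 * (u powr (- \<epsilon>) * b u))"
      by (rule mult_left_mono) simp
    moreover have "(c * u) powr \<epsilon> * (c * u) powr (- \<epsilon>) = 1" "(c * u) powr \<epsilon> * u powr (- \<epsilon>) = c powr \<epsilon>"
      using c u by (simp flip: powr_add) (use c u in \<open>simp add: powr_mult mult.assoc flip: powr_add\<close>)
    ultimately have "b (c * u) \<le> D\<^sup>2 * c powr \<epsilon> * b u"
      by (metis mult.assoc mult.commute mult.left_neutral)
    also have "\<dots> \<le> (C\<^sup>2 + D\<^sup>2) * c powr \<epsilon> * b u"
      using pos[OF u] by (intro mult_right_mono) auto
    finally show "b (c * u) \<le> (C\<^sup>2 + D\<^sup>2) * c powr \<epsilon> * b u" .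
  qed
  moreover define E where "E = C\<^sup>2 + D\<^sup>2"
  ultimately have b: "b (c * u) \<le> E * c powr \<epsilon> * b u" "b u \<le> E * c powr \<epsilon> * b (c * u)"
    if "1 \<le> c" "0 < u" for c u
    using that by blast+
  have E: "ennreal (b x) \<le> ennreal E * ennreal (c powr \<epsilon>) * ennreal (b y)"
    if "b x \<le> E * c powr \<epsilon> * b y" "0 < y" for x y c
    using that pos[of y] by (simp add: ennreal_leI flip: ennreal_mult'')
  show "\<exists>C<top. \<forall>c\<ge>1. \<forall>p\<in>{0<..}.
      ennreal (b (c *\<^sub>R p)) \<le> C * ennreal (c powr \<epsilon>) * ennreal (b p) \<and>
      ennreal (b p) \<le> C * ennreal (c powr \<epsilon>) * ennreal (b (c *\<^sub>R p))"
    by (intro exI[of _ "ennreal E"]) (auto intro!: E b)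
qed

lemma slow_on_invariant:
  assumes "\<And>c p. 1 \<le> c \<Longrightarrow> p \<in> P \<Longrightarrow> F (c *\<^sub>R p) = F p"
  shows "slow_on P F"
proof (rule slow_onI)
  fix \<epsilon> :: real assume e: "0 < \<epsilon>"
  have "F p \<le> 1 * ennreal (c powr \<epsilon>) * F p" if "1 \<le> c" for c p
  proof -
    have "ennreal 1 * F p \<le> ennreal (c powr \<epsilon>) * F p"
      using that e by (intro mult_right_mono ennreal_leI) (auto simp: ge_one_powr_ge_zero)
    then show ?thesis by simp
  qed
  then show "\<exists>C<top. \<forall>c\<ge>1. \<forall>p\<in>P. F (c *\<^sub>R p) \<le> C * ennreal (c powr \<epsilon>) * F p \<and> F p \<le> C * ennreal (c powr \<epsilon>) * F (c *\<^sub>R p)"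
    using assms by (intro exI[of _ 1]) auto
qed

lemma slow_on_mult:
  assumes "slow_on P F" "slow_on P G"
  shows "slow_on P (\<lambda>p. F p * G p)"
proof (rule slow_onI)
  fix \<epsilon> :: real assume e: "0 < \<epsilon>"
  then have e2: "0 < \<epsilon> / 2" by simp
  obtain C where C: "C < top"
    "\<And>c p. 1 \<le> c \<Longrightarrow> p \<in> P \<Longrightarrow> F (c *\<^sub>R p) \<le> C * ennreal (c powr (\<epsilon>/2)) * F p"
    "\<And>c p. 1 \<le> c \<Longrightarrow> p \<in> P \<Longrightarrow> F p \<le> C * ennreal (c powr (\<epsilon>/2)) * F (c *\<^sub>R p)"
    using slow_onD[OF assms(1) e2] by blast
  obtain D where D: "D < top"
    "\<And>c p. 1 \<le> c \<Longrightarrow> p \<in> P \<Longrightarrow> G (c *\<^sub>R p) \<le> D * ennreal (c powr (\<epsilon>/2)) * G p"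
    "\<And>c p. 1 \<le> c \<Longrightarrow> p \<in> P \<Longrightarrow> G p \<le> D * ennreal (c powr (\<epsilon>/2)) * G (c *\<^sub>R p)"
    using slow_onD[OF assms(2) e2] by blast
  have eq: "C * ennreal (c powr (\<epsilon>/2)) * x * (D * ennreal (c powr (\<epsilon>/2)) * y)
    = C * D * ennreal (c powr \<epsilon>) * (x * y)" for c x y
  proof -
    have "ennreal (c powr \<epsilon>) = ennreal (c powr (\<epsilon>/2)) * ennreal (c powr (\<epsilon>/2))"
      by (simp flip: ennreal_mult'' powr_add)
    then show ?thesis by (simp add: algebra_simps)
  qed
  have "F (c *\<^sub>R p) * G (c *\<^sub>R p) \<le> C * D * ennreal (c powr \<epsilon>) * (F p * G p) \<and>
    F p * G p \<le> C * D * ennreal (c powr \<epsilon>) * (F (c *\<^sub>R p) * G (c *\<^sub>R p))" if "1 \<le> c" "p \<in> P" for c p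
    using mult_mono[OF C(2) D(2), OF that that] mult_mono[OF C(3) D(3), OF that that]
    by (simp add: eq)
  then show "\<exists>C<top. \<forall>c\<ge>1. \<forall>p\<in>P. F (c *\<^sub>R p) * G (c *\<^sub>R p) \<le> C * ennreal (c powr \<epsilon>) * (F p * G p) \<and>
      F p * G p \<le> C * ennreal (c powr \<epsilon>) * (F (c *\<^sub>R p) * G (c *\<^sub>R p))"
    using C(1) D(1) by (intro exI[of _ "C * D"]) (auto simp: ennreal_mult_less_top)
qed

lemma slow_on_add:
  assumes "slow_on P F" "slow_on P G"
  shows "slow_on P (\<lambda>p. F p + G p)"
proof (rule slow_onI)
  fix \<epsilon> :: real assume e: "0 < \<epsilon>"
  obtain C where C: "C < top"
    "\<And>c p. 1 \<le> c \<Longrightarrow> p \<in> P \<Longrightarrow> F (c *\<^sub>R p) \<le> C * ennreal (c powr \<epsilon>) * F p"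
    "\<And>c p. 1 \<le> c \<Longrightarrow> p \<in> P \<Longrightarrow> F p \<le> C * ennreal (c powr \<epsilon>) * F (c *\<^sub>R p)"
    using slow_onD[OF assms(1) e] by blast
  obtain D where D: "D < top"
    "\<And>c p. 1 \<le> c \<Longrightarrow> p \<in> P \<Longrightarrow> G (c *\<^sub>R p) \<le> D * ennreal (c powr \<epsilon>) * G p"
    "\<And>c p. 1 \<le> c \<Longrightarrow> p \<in> P \<Longrightarrow> G p \<le> D * ennreal (c powr \<epsilon>) * G (c *\<^sub>R p)"
    using slow_onD[OF assms(2) e] by blast
  have le: "C * z * x + D * z * y \<le> (C + D) * z * (x + y)" for x y z
    by (simp add: algebra_simps add_mono add_increasing2)
  have "F (c *\<^sub>R p) + G (c *\<^sub>R p) \<le> (C + D) * ennreal (c powr \<epsilon>) * (F p + G p) \<and>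
    F p + G p \<le> (C + D) * ennreal (c powr \<epsilon>) * (F (c *\<^sub>R p) + G (c *\<^sub>R p))" if "1 \<le> c" "p \<in> P" for c p
    using order_trans[OF add_mono[OF C(2) D(2), OF that that] le] order_trans[OF add_mono[OF C(3) D(3), OF that that] le]
    by simp
  then show "\<exists>C<top. \<forall>c\<ge>1. \<forall>p\<in>P. F (c *\<^sub>R p) + G (c *\<^sub>R p) \<le> C * ennreal (c powr \<epsilon>) * (F p + G p) \<and>
      F p + G p \<le> C * ennreal (c powr \<epsilon>) * (F (c *\<^sub>R p) + G (c *\<^sub>R p))"
    using C(1) D(1) by (intro exI[of _ "C + D"]) auto
qed

lemma slow_on_snd:
  assumes "slow_on {0<..} B"
  shows "slow_on (P \<times> {0<..}) (\<lambda>p. B (snd p))"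
proof (rule slow_onI)
  fix \<epsilon> :: real assume "0 < \<epsilon>"
  then obtain C where "C < top"
    "\<And>c p. 1 \<le> c \<Longrightarrow> p \<in> {0<..} \<Longrightarrow> B (c *\<^sub>R p) \<le> C * ennreal (c powr \<epsilon>) * B p"
    "\<And>c p. 1 \<le> c \<Longrightarrow> p \<in> {0<..} \<Longrightarrow> B p \<le> C * ennreal (c powr \<epsilon>) * B (c *\<^sub>R p)"
    using slow_onD[OF assms] by blast
  then show "\<exists>C<top. \<forall>c\<ge>1. \<forall>p\<in>P \<times> {0<..}.
      B (snd (c *\<^sub>R p)) \<le> C * ennreal (c powr \<epsilon>) * B (snd p) \<and>
      B (snd p) \<le> C * ennreal (c powr \<epsilon>) * B (snd (c *\<^sub>R p))"
    by (intro exI[of _ C]) auto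
qed

text \<open>Integrating out the last variable preserves slow variation: substituting \<open>c u\<close> for \<open>u\<close> does not
  change the norm and turns a dilation of the parameters into one of all variables. Sharp cut-offs
  such as the indicator of \<open>t < u\<close> are invariant under joint dilations and hence admissible
  (\<open>slow_on_invariant\<close>).\<close>
lemma slow_on_N:
  assumes F: "slow_on (P \<times> {0<..}) F" and q: "0 < q"
    and P: "\<And>c p. 1 \<le> c \<Longrightarrow> p \<in> P \<Longrightarrow> c *\<^sub>R p \<in> P"
    and m [measurable]: "\<And>p. p \<in> P \<Longrightarrow> (\<lambda>u. F (p, u)) \<in> borel_measurable dlog"
  shows "slow_on P (\<lambda>p. N q (\<lambda>u. F (p, u)))"
proof (rule slow_onI)
  fix \<epsilon> :: real assume e: "0 < \<epsilon>"
  obtain C where C: "C < top"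
    "\<And>c p. 1 \<le> c \<Longrightarrow> p \<in> P \<times> {0<..} \<Longrightarrow> F (c *\<^sub>R p) \<le> C * ennreal (c powr \<epsilon>) * F p"
    "\<And>c p. 1 \<le> c \<Longrightarrow> p \<in> P \<times> {0<..} \<Longrightarrow> F p \<le> C * ennreal (c powr \<epsilon>) * F (c *\<^sub>R p)"
    using slow_onD[OF F e] by blast
  have "N q (\<lambda>u. F (c *\<^sub>R p, u)) \<le> C * ennreal (c powr \<epsilon>) * N q (\<lambda>u. F (p, u)) \<and>
    N q (\<lambda>u. F (p, u)) \<le> C * ennreal (c powr \<epsilon>) * N q (\<lambda>u. F (c *\<^sub>R p, u))"
    if c: "1 \<le> c" and p: "p \<in> P" for c p
  proof -
    have c0: "0 < c" using c by simp
    note cp [measurable] = m[OF P[OF c p]] and [measurable] = m[OF p]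
    note [measurable] = measurable_compose[OF scale_measurable_dlog[OF c0] cp]
    have "N q (\<lambda>u. F (c *\<^sub>R p, u)) = N q (\<lambda>u. F (c *\<^sub>R p, c * u))"
      by (rule N_scale[symmetric, OF c0]) measurable
    moreover have "N q (\<lambda>u. F (c *\<^sub>R p, c * u)) \<le> C * ennreal (c powr \<epsilon>) * N q (\<lambda>u. F (p, u))"
      using C(2)[OF c, of "(p, _)"] p by (intro N_le_cmult[OF q]) auto
    moreover have "N q (\<lambda>u. F (p, u)) \<le> C * ennreal (c powr \<epsilon>) * N q (\<lambda>u. F (c *\<^sub>R p, c * u))"
      using C(3)[OF c, of "(p, _)"] p by (intro N_le_cmult[OF q]) auto
    ultimately show ?thesis by simp
  qed
  then show "\<exists>C<top. \<forall>c\<ge>1. \<forall>p\<in>P. N q (\<lambda>u. F (c *\<^sub>R p, u)) \<le> C * ennreal (c powr \<epsilon>) * N q (\<lambda>u. F (p, u)) \<and>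
      N q (\<lambda>u. F (p, u)) \<le> C * ennreal (c powr \<epsilon>) * N q (\<lambda>u. F (c *\<^sub>R p, u))"
    using C(1) by blast
qed

abbreviation slow :: "(real \<Rightarrow> ennreal) \<Rightarrow> bool" where
  "slow \<equiv> slow_on {0<..}"

lemma slow_tail:
  assumes "slow B" "0 < q" and [measurable]: "B \<in> borel_measurable dlog"
  shows "slow (\<lambda>t. N q (\<lambda>u. indicator {t<..} u * B u))"
proof -
  have "slow (\<lambda>t. N q (\<lambda>u. (\<lambda>p. indicator {fst p<..} (snd p) * B (snd p)) (t, u)))"
    by (intro slow_on_N slow_on_mult slow_on_snd assms slow_on_invariant)
      (auto split: split_indicator)
  then show ?thesis by simp
qed

lemma slow_head:
  assumes "slow B" "0 < q" and [measurable]: "B \<in> borel_measurable dlog"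
  shows "slow (\<lambda>t. N q (\<lambda>u. indicator {0<..<t} u * B u))"
proof -
  have "slow (\<lambda>t. N q (\<lambda>u. (\<lambda>p. indicator {0<..<fst p} (snd p) * B (snd p)) (t, u)))"
    by (intro slow_on_N slow_on_mult slow_on_snd assms slow_on_invariant)
      (auto split: split_indicator)
  then show ?thesis by simp
qed

lemma slow_potter:
  assumes "slow B" "0 < \<epsilon>"
  obtains C where "C < top"
    "\<And>t u. 0 < t \<Longrightarrow> t \<le> u \<Longrightarrow> B u \<le> C * ennreal ((u / t) powr \<epsilon>) * B t"
    "\<And>t u. 0 < t \<Longrightarrow> t \<le> u \<Longrightarrow> B t \<le> C * ennreal ((u / t) powr \<epsilon>) * B u"
proof -
  obtain C where C: "C < top"
    "\<And>c p. 1 \<le> c \<Longrightarrow> p \<in> {0<..} \<Longrightarrow> B (c *\<^sub>R p) \<le> C * ennreal (c powr \<epsilon>) * B p"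
    "\<And>c p. 1 \<le> c \<Longrightarrow> p \<in> {0<..} \<Longrightarrow> B p \<le> C * ennreal (c powr \<epsilon>) * B (c *\<^sub>R p)"
    using slow_onD[OF assms] by blast
  show ?thesis
    by (rule that[OF C(1)]) (use C(2)[of "u / t" t for u t] C(3)[of "u / t" t for u t] in auto)
qed

text \<open>Half of the power compensates the growth of \<open>B\<close> relative to \<open>B(t)\<close>; the other half is
  still integrable.\<close>
lemma slow_power_tail:
  assumes B: "slow B" and q: "0 < q" and [measurable]: "B \<in> borel_measurable dlog" and d: "0 < \<delta>"
  shows "\<exists>C<top. \<forall>t>0. N q (\<lambda>u. indicator {t<..} u * (ennreal (u powr (- \<delta>)) * B u))
    \<le> C * (ennreal (t powr (- \<delta>)) * B t)"
proof -
  have d2: "0 < \<delta> / 2" using d by simp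
  obtain C where C: "C < top"
    "\<And>t u. 0 < t \<Longrightarrow> t \<le> u \<Longrightarrow> B u \<le> C * ennreal ((u / t) powr (\<delta> / 2)) * B t"
    using slow_potter[OF B d2] by metis
  obtain D where D: "D < top"
    "\<And>t. 0 < t \<Longrightarrow> N q (\<lambda>u. indicator {t<..} u * ennreal (u powr (- (\<delta> / 2)))) \<le> D * ennreal (t powr (- (\<delta> / 2)))"
    using power_tail[OF q d2] by blast
  have "N q (\<lambda>u. indicator {t<..} u * (ennreal (u powr (- \<delta>)) * B u)) \<le> C * D * (ennreal (t powr (- \<delta>)) * B t)"
    if t: "0 < t" for t
  proof -
    have "N q (\<lambda>u. indicator {t<..} u * (ennreal (u powr (- \<delta>)) * B u))
      \<le> (C * ennreal (t powr (- (\<delta> / 2))) * B t) * N q (\<lambda>u. indicator {t<..} u * ennreal (u powr (- (\<delta> / 2))))"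
    proof (rule N_le_cmult[OF q], measurable)
      fix u :: real assume u: "0 < u"
      show "indicator {t<..} u * (ennreal (u powr - \<delta>) * B u)
         \<le> C * ennreal (t powr - (\<delta> / 2)) * B t * (indicator {t<..} u * ennreal (u powr - (\<delta> / 2)))"
      proof (cases "t < u")
        case True
        have "u powr - \<delta> * (u / t) powr (\<delta> / 2) = t powr - (\<delta> / 2) * u powr - (\<delta> / 2)"
        proof -
          have "(u / t) powr (\<delta> / 2) = u powr (\<delta> / 2) * t powr - (\<delta> / 2)"
            using t u by (simp add: powr_divide powr_minus_divide)
          moreover have "u powr - \<delta> * u powr (\<delta> / 2) = u powr - (\<delta> / 2)"
            by (simp flip: powr_add)
          ultimately show ?thesis by (metis mult.assoc mult.commute)
        qed
        then have e: "ennreal (u powr - \<delta>) * ennreal ((u / t) powr (\<delta> / 2)) = ennreal (t powr - (\<delta> / 2)) * ennreal (u powr - (\<delta> / 2))"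
          by (simp flip: ennreal_mult'')
        have "ennreal (u powr - \<delta>) * B u \<le> ennreal (u powr - \<delta>) * (C * ennreal ((u / t) powr (\<delta> / 2)) * B t)"
          using C(2)[OF t, of u] True by (intro mult_left_mono) auto
        also have "\<dots> = C * (ennreal (u powr - \<delta>) * ennreal ((u / t) powr (\<delta> / 2))) * B t"
          by (simp add: mult_ac)
        finally show ?thesis using True unfolding e by (simp add: mult_ac)
      qed auto
    qed
    also have "\<dots> \<le> (C * ennreal (t powr (- (\<delta> / 2))) * B t) * (D * ennreal (t powr (- (\<delta> / 2))))"
      by (intro mult_left_mono D t) simp
    also have "\<dots> = C * D * (ennreal (t powr (- (\<delta> / 2))) * ennreal (t powr (- (\<delta> / 2))) * B t)"
      by (simp add: mult_ac)
    also have "ennreal (t powr (- (\<delta> / 2))) * ennreal (t powr (- (\<delta> / 2))) = ennreal (t powr (- \<delta>))"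
      by (simp flip: ennreal_mult'' powr_add)
    finally show ?thesis .
  qed
  then show ?thesis using C(1) D(1) by (intro exI[of _ "C * D"]) (auto simp: ennreal_mult_less_top)
qed

lemma slow_power_head:
  assumes B: "slow B" and q: "0 < q" and [measurable]: "B \<in> borel_measurable dlog" and d: "0 < \<delta>"
  shows "\<exists>C<top. \<forall>t>0. N q (\<lambda>u. indicator {0<..<t} u * (ennreal (u powr \<delta>) * B u))
    \<le> C * (ennreal (t powr \<delta>) * B t)"
proof -
  have d2: "0 < \<delta> / 2" using d by simp
  obtain C where C: "C < top"
    "\<And>t u. 0 < t \<Longrightarrow> t \<le> u \<Longrightarrow> B t \<le> C * ennreal ((u / t) powr (\<delta> / 2)) * B u"
    using slow_potter[OF B d2] by metis
  obtain D where D: "D < top"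
    "\<And>t. 0 < t \<Longrightarrow> N q (\<lambda>u. indicator {0<..<t} u * ennreal (u powr (\<delta> / 2))) \<le> D * ennreal (t powr (\<delta> / 2))"
    using power_head[OF q d2] by blast
  have "N q (\<lambda>u. indicator {0<..<t} u * (ennreal (u powr \<delta>) * B u)) \<le> C * D * (ennreal (t powr \<delta>) * B t)"
    if t: "0 < t" for t
  proof -
    have "N q (\<lambda>u. indicator {0<..<t} u * (ennreal (u powr \<delta>) * B u))
      \<le> (C * ennreal (t powr (\<delta> / 2)) * B t) * N q (\<lambda>u. indicator {0<..<t} u * ennreal (u powr (\<delta> / 2)))"
    proof (rule N_le_cmult[OF q], measurable)
      fix u :: real assume u: "0 < u"
      show "indicator {0<..<t} u * (ennreal (u powr \<delta>) * B u)
         \<le> C * ennreal (t powr (\<delta> / 2)) * B t * (indicator {0<..<t} u * ennreal (u powr (\<delta> / 2)))"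
      proof (cases "u < t")
        case True
        have "u powr \<delta> * (t / u) powr (\<delta> / 2) = t powr (\<delta> / 2) * u powr (\<delta> / 2)"
        proof -
          have "(t / u) powr (\<delta> / 2) = t powr (\<delta> / 2) * u powr - (\<delta> / 2)"
            using t u by (simp add: powr_divide powr_minus_divide)
          moreover have "u powr \<delta> * u powr - (\<delta> / 2) = u powr (\<delta> / 2)"
            by (simp flip: powr_add)
          ultimately show ?thesis by (metis mult.assoc mult.commute)
        qed
        then have e: "ennreal (u powr \<delta>) * ennreal ((t / u) powr (\<delta> / 2)) = ennreal (t powr (\<delta> / 2)) * ennreal (u powr (\<delta> / 2))"
          by (simp flip: ennreal_mult'')
        have "ennreal (u powr \<delta>) * B u \<le> ennreal (u powr \<delta>) * (C * ennreal ((t / u) powr (\<delta> / 2)) * B t)"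
          using C(2)[OF u, of t] True by (intro mult_left_mono) auto
        also have "\<dots> = C * (ennreal (u powr \<delta>) * ennreal ((t / u) powr (\<delta> / 2))) * B t"
          by (simp add: mult_ac)
        finally show ?thesis using True u unfolding e by (simp add: mult_ac)
      qed auto
    qed
    also have "\<dots> \<le> (C * ennreal (t powr (\<delta> / 2)) * B t) * (D * ennreal (t powr (\<delta> / 2)))"
      by (intro mult_left_mono D t) simp
    also have "\<dots> = C * D * (ennreal (t powr (\<delta> / 2)) * ennreal (t powr (\<delta> / 2)) * B t)"
      by (simp add: mult_ac)
    also have "ennreal (t powr (\<delta> / 2)) * ennreal (t powr (\<delta> / 2)) = ennreal (t powr \<delta>)"
      by (simp flip: ennreal_mult'' powr_add)
    finally show ?thesis .
  qed
  then show ?thesis using C(1) D(1) by (intro exI[of _ "C * D"]) (auto simp: ennreal_mult_less_top)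
qed

text \<open>On \<open>(t,2t)\<close> the function is comparable to its value at \<open>t\<close>.\<close>
lemma slow_le_dyadic:
  assumes B: "slow B" and q: "0 < q" and [measurable]: "B \<in> borel_measurable dlog"
  shows "\<exists>C<top. \<forall>t>0. B t \<le> C * N q (\<lambda>u. indicator {t<..<2 * t} u * B u)"
proof -
  let ?m = "N q (indicator {1<..<2})"
  obtain C where C: "C < top"
    "\<And>t u. 0 < t \<Longrightarrow> t \<le> u \<Longrightarrow> B t \<le> C * ennreal ((u / t) powr 1) * B u"
    using slow_potter[OF B zero_less_one] by metis
  have "B t \<le> 2 * C / ?m * N q (\<lambda>u. indicator {t<..<2 * t} u * B u)" if t: "0 < t" for t
  proof -
    have "N q (indicator {t<..<2 * t}) = N q (\<lambda>u. indicator {t<..<2 * t} (t * u))"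
      by (rule N_scale[symmetric, OF t]) measurable
    also have "(\<lambda>u. indicator {t<..<2 * t} (t * u)) = (indicator {1<..<2} :: real \<Rightarrow> ennreal)"
      using t by (auto simp: fun_eq_iff split: split_indicator)
    finally have m: "N q (indicator {t<..<2 * t}) = ?m" .
    have "B t * N q (indicator {t<..<2 * t}) = N q (\<lambda>u. B t * indicator {t<..<2 * t} u)"
      by (rule Lp_norm_cmult[OF q, symmetric]) measurable
    also have "\<dots> \<le> 2 * C * N q (\<lambda>u. indicator {t<..<2 * t} u * B u)"
    proof (rule N_le_cmult[OF q], measurable)
      fix u :: real
      have "B t \<le> 2 * C * B u" if "t < u" "u < 2 * t"
      proof -
        have "B t \<le> C * ennreal ((u / t) powr 1) * B u" using C(2)[OF t, of u] that by simp
        also have "\<dots> \<le> C * ennreal 2 * B u"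
          using that t by (intro mult_left_mono mult_right_mono ennreal_leI) (auto simp: field_simps)
        finally show ?thesis by (simp add: mult_ac)
      qed
      then show "B t * indicator {t<..<2 * t} u \<le> 2 * C * (indicator {t<..<2 * t} u * B u)"
        by (auto split: split_indicator)
    qed
    finally have "B t * ?m / ?m \<le> 2 * C * N q (\<lambda>u. indicator {t<..<2 * t} u * B u) / ?m"
      unfolding m by (rule divide_right_mono_ennreal)
    moreover have "B t * ?m / ?m = B t"
      using N_dyadic[OF q] by (intro mult_divide_eq_ennreal) auto
    ultimately show ?thesis
      by (simp add: divide_ennreal_def mult_ac)
  qed
  moreover have "2 * C / ?m < top"
    using N_dyadic[OF q] C(1) by (auto simp: less_top[symmetric] ennreal_divide_eq_top_iff ennreal_mult_eq_top_iff)
  ultimately show ?thesis by blast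
qed

lemma N_cmult_le_cmult:
  assumes q: "0 < q" and m: "f \<in> borel_measurable dlog" "g \<in> borel_measurable dlog"
    and le: "\<And>u. 0 < u \<Longrightarrow> c * f u \<le> d * g u"
  shows "c * N q f \<le> d * N q g"
  using N_le_cmult[OF q _ m(2), of "\<lambda>u. c * f u" d] le m(1) by (simp add: Lp_norm_cmult[OF q m(1)])

lemma AE_dlog_neq: "AE u in dlog. u \<noteq> t"
  unfolding AE_dlog_iff
  by (rule AE_completion) (use AE_lborel_singleton[of t] in \<open>auto elim!: eventually_mono\<close>)

section \<open>Iterated norms\<close>

text \<open>One shape for all iterated norms of the theorem: \<open>s\<close> ranges over \<open>J\<close> and \<open>u\<close> over \<open>(x,s)\<close>. For
  \<open>s \<le> x\<close> the inner norm vanishes.\<close>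
definition inorm ::
  "ennreal \<Rightarrow> (real \<Rightarrow> ennreal) \<Rightarrow> ennreal \<Rightarrow> real set \<Rightarrow> real \<Rightarrow> (real \<Rightarrow> ennreal) \<Rightarrow> ennreal" where
  "inorm r b q J x g = N r (\<lambda>s. indicator J s * (b s * N q (\<lambda>u. indicator {x<..<s} u * g u)))"

lemma inorm_cmult_le_cmult:
  assumes r: "0 < r" and q: "0 < q"
    and [measurable]: "b \<in> borel_measurable dlog" "g \<in> borel_measurable dlog" "h \<in> borel_measurable dlog"
      "J \<in> sets borel" "J' \<in> sets borel"
    and J: "J \<subseteq> J'" and x: "x' \<le> x"
    and le: "\<And>u s. 0 < u \<Longrightarrow> x < u \<Longrightarrow> s \<in> J \<Longrightarrow> u < s \<Longrightarrow> c * g u \<le> d * h u"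
  shows "c * inorm r b q J x g \<le> d * inorm r b q J' x' h"
  unfolding inorm_def
proof (rule N_cmult_le_cmult[OF r])
  fix s :: real assume s: "0 < s"
  show "c * (indicator J s * (b s * N q (\<lambda>u. indicator {x<..<s} u * g u)))
      \<le> d * (indicator J' s * (b s * N q (\<lambda>u. indicator {x'<..<s} u * h u)))"
  proof (cases "s \<in> J")
    case True
    have "c * N q (\<lambda>u. indicator {x<..<s} u * g u) \<le> d * N q (\<lambda>u. indicator {x'<..<s} u * h u)"
      by (rule N_cmult_le_cmult[OF q], measurable)
        (use le True x in \<open>auto split: split_indicator\<close>)
    then have "b s * (c * N q (\<lambda>u. indicator {x<..<s} u * g u)) \<le> b s * (d * N q (\<lambda>u. indicator {x'<..<s} u * h u))"
      by (rule mult_left_mono) simp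
    then show ?thesis using True J by (auto simp: subset_iff mult.left_commute)
  qed auto
qed (use q in measurable)

lemma inorm_le_cmult:
  assumes "0 < r" "0 < q"
    and "b \<in> borel_measurable dlog" "g \<in> borel_measurable dlog" "h \<in> borel_measurable dlog"
      "J \<in> sets borel" "J' \<in> sets borel"
    and "J \<subseteq> J'" "x' \<le> x"
    and "\<And>u s. 0 < u \<Longrightarrow> x < u \<Longrightarrow> s \<in> J \<Longrightarrow> u < s \<Longrightarrow> g u \<le> d * h u"
  shows "inorm r b q J x g \<le> d * inorm r b q J' x' h"
  using inorm_cmult_le_cmult[of r q b g h J J' x' x 1 d] assms by simp

lemma inorm_mono:
  assumes "0 < r" "0 < q"
    and "b \<in> borel_measurable dlog" "g \<in> borel_measurable dlog" "h \<in> borel_measurable dlog"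
      "J \<in> sets borel" "J' \<in> sets borel"
    and "J \<subseteq> J'" "x' \<le> x"
    and "\<And>u s. 0 < u \<Longrightarrow> x < u \<Longrightarrow> s \<in> J \<Longrightarrow> u < s \<Longrightarrow> g u \<le> h u"
  shows "inorm r b q J x g \<le> inorm r b q J' x' h"
  using inorm_cmult_le_cmult[of r q b g h J J' x' x 1 1] assms by simp

lemma inorm_add:
  assumes r: "0 < r" and q: "0 < q" and [measurable]: "b \<in> borel_measurable dlog"
  shows "\<exists>C<top. \<forall>J\<in>sets borel. \<forall>x. \<forall>g\<in>borel_measurable dlog. \<forall>h\<in>borel_measurable dlog.
    inorm r b q J x (\<lambda>u. g u + h u) \<le> C * (inorm r b q J x g + inorm r b q J x h)"
proof -
  obtain C where C: "C < top" "\<And>g h. g \<in> borel_measurable dlog \<Longrightarrow> h \<in> borel_measurable dlog \<Longrightarrow>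
      N q (\<lambda>u. g u + h u) \<le> C * (N q g + N q h)"
    using Lp_norm_add[OF q] by blast
  obtain D where D: "D < top" "\<And>g h. g \<in> borel_measurable dlog \<Longrightarrow> h \<in> borel_measurable dlog \<Longrightarrow>
      N r (\<lambda>u. g u + h u) \<le> D * (N r g + N r h)"
    using Lp_norm_add[OF r] by blast
  have "inorm r b q J x (\<lambda>u. g u + h u) \<le> C * D * (inorm r b q J x g + inorm r b q J x h)"
    if [measurable]: "J \<in> sets borel" "g \<in> borel_measurable dlog" "h \<in> borel_measurable dlog" for J x g h
  proof -
    define G where "G s = N q (\<lambda>u. indicator {x<..<s} u * g u)" for s
    define H where "H s = N q (\<lambda>u. indicator {x<..<s} u * h u)" for s
    have [measurable]: "G \<in> borel_measurable dlog" "H \<in> borel_measurable dlog"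
      unfolding G_def H_def using q by measurable
    have "inorm r b q J x (\<lambda>u. g u + h u) \<le> C * N r (\<lambda>s. indicator J s * (b s * G s) + indicator J s * (b s * H s))"
      unfolding inorm_def
    proof (rule N_le_cmult[OF r])
      fix s :: real
      have "N q (\<lambda>u. indicator {x<..<s} u * g u + indicator {x<..<s} u * h u) \<le> C * (G s + H s)"
        unfolding G_def H_def by (intro C) measurable
      then have "N q (\<lambda>u. indicator {x<..<s} u * (g u + h u)) \<le> C * (G s + H s)"
        by (simp only: distrib_left)
      then have "indicator J s * b s * N q (\<lambda>u. indicator {x<..<s} u * (g u + h u)) \<le> indicator J s * b s * (C * (G s + H s))"
        by (rule mult_left_mono) simp
      also have "\<dots> = C * (indicator J s * (b s * G s) + indicator J s * (b s * H s))"
        by (simp add: algebra_simps)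
      finally show "indicator J s * (b s * N q (\<lambda>u. indicator {x<..<s} u * (g u + h u)))
         \<le> C * (indicator J s * (b s * G s) + indicator J s * (b s * H s))"
        by (simp add: mult.assoc)
    qed (use q in measurable)
    also have "\<dots> \<le> C * (D * (N r (\<lambda>s. indicator J s * (b s * G s)) + N r (\<lambda>s. indicator J s * (b s * H s))))"
      by (intro mult_left_mono D) auto
    finally show ?thesis
      by (simp add: inorm_def G_def H_def mult.assoc)
  qed
  then show ?thesis using C(1) D(1) by (intro exI[of _ "C * D"]) (auto simp: ennreal_mult_less_top)
qed

text \<open>For \<open>s \<in> J'\<close> the inner norm is at least the norm over \<open>(x',y)\<close>, which does not depend on \<open>s\<close>.\<close>
lemma product_le_inorm:
  assumes r: "0 < r" and q: "0 < q"
    and [measurable]: "b \<in> borel_measurable dlog" "g \<in> borel_measurable dlog" "J \<in> sets borel" "J' \<in> sets borel"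
    and J: "J' \<subseteq> J" "\<And>s. s \<in> J' \<Longrightarrow> y \<le> s" and x: "x \<le> x'"
  shows "N r (\<lambda>s. indicator J' s * b s) * N q (\<lambda>u. indicator {x'<..<y} u * g u) \<le> inorm r b q J x g"
proof -
  have "N q (\<lambda>u. indicator {x'<..<y} u * g u) * N r (\<lambda>s. indicator J' s * b s)
      \<le> 1 * inorm r b q J x g"
    unfolding inorm_def
  proof (rule N_cmult_le_cmult[OF r])
    fix s :: real
    have "N q (\<lambda>u. indicator {x'<..<y} u * g u) \<le> N q (\<lambda>u. indicator {x<..<s} u * g u)" if "s \<in> J'"
      by (rule N_mono[OF q], measurable) (use J(2)[OF that] x in \<open>auto split: split_indicator\<close>)
    then show "N q (\<lambda>u. indicator {x'<..<y} u * g u) * (indicator J' s * b s)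
      \<le> 1 * (indicator J s * (b s * N q (\<lambda>u. indicator {x<..<s} u * g u)))"
      using J(1) by (auto simp: mult.commute subset_iff intro!: mult_left_mono split: split_indicator)
  qed (use q in measurable)
  then show ?thesis by (simp add: mult.commute)
qed

lemma inorm_le_product:
  assumes r: "0 < r" and q: "0 < q"
    and [measurable]: "b \<in> borel_measurable dlog" "g \<in> borel_measurable dlog" "J \<in> sets borel"
  shows "inorm r b q J x g \<le> N r (\<lambda>s. indicator J s * b s) * N q (\<lambda>u. indicator {x<..} u * g u)"
proof -
  have "inorm r b q J x g \<le> N q (\<lambda>u. indicator {x<..} u * g u) * N r (\<lambda>s. indicator J s * b s)"
    unfolding inorm_def
  proof (rule N_le_cmult[OF r])
    fix s :: real
    have "N q (\<lambda>u. indicator {x<..<s} u * g u) \<le> N q (\<lambda>u. indicator {x<..} u * g u)"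
      by (rule N_mono[OF q], measurable) (auto split: split_indicator)
    then show "indicator J s * (b s * N q (\<lambda>u. indicator {x<..<s} u * g u))
      \<le> N q (\<lambda>u. indicator {x<..} u * g u) * (indicator J s * b s)"
      by (auto simp: mult.commute intro!: mult_left_mono split: split_indicator)
  qed (use q in measurable)
  then show ?thesis by (simp add: mult.commute)
qed

text \<open>For \<open>s > t\<close> the inner interval \<open>(0,s)\<close> is split at \<open>t\<close>. The mixed region \<open>u < t < s\<close> is a
  product, which gives the middle term.\<close>
lemma inorm_split:
  assumes r: "0 < r" and q: "0 < q" and [measurable]: "b \<in> borel_measurable dlog"
  shows "\<exists>C<top. \<forall>t>0. \<forall>g\<in>borel_measurable dlog.
    inorm r b q UNIV 0 g \<le> C * (inorm r b q {..<t} 0 g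
      + N r (\<lambda>s. indicator {t<..} s * b s) * N q (\<lambda>u. indicator {0<..<t} u * g u) + inorm r b q {t<..} t g)"
proof -
  obtain C where C: "C < top" "\<And>g h. g \<in> borel_measurable dlog \<Longrightarrow> h \<in> borel_measurable dlog \<Longrightarrow>
      N q (\<lambda>u. g u + h u) \<le> C * (N q g + N q h)"
    using Lp_norm_add[OF q] by blast
  obtain D where D: "D < top" "\<And>g h. g \<in> borel_measurable dlog \<Longrightarrow> h \<in> borel_measurable dlog \<Longrightarrow>
      N r (\<lambda>u. g u + h u) \<le> D * (N r g + N r h)"
    using Lp_norm_add[OF r] by blast
  let ?E = "D * (1 + C * D)"
  have "inorm r b q UNIV 0 g \<le> ?E * (inorm r b q {..<t} 0 g
      + N r (\<lambda>s. indicator {t<..} s * b s) * N q (\<lambda>u. indicator {0<..<t} u * g u) + inorm r b q {t<..} t g)"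
    if t: "0 < t" and [measurable]: "g \<in> borel_measurable dlog" for t g
  proof -
    define G where "G s = N q (\<lambda>u. indicator {0<..<s} u * g u)" for s
    define H where "H s = N q (\<lambda>u. indicator {t<..<s} u * g u)" for s
    have [measurable]: "G \<in> borel_measurable dlog" "H \<in> borel_measurable dlog"
      unfolding G_def H_def using q by measurable
    have GH: "G s \<le> C * (G t + H s)" if "t < s" for s
    proof -
      (* The point u = t belongs to neither interval, so the bound holds almost everywhere only. *)
      have "G s \<le> N q (\<lambda>u. indicator {0<..<t} u * g u + indicator {t<..<s} u * g u)"
        unfolding G_def
        by (rule Lp_norm_mono[OF q]) (measurable, use AE_dlog_neq[of t] in eventually_elim, use t in \<open>auto split: split_indicator\<close>)
      also have "\<dots> \<le> C * (G t + H s)"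
        unfolding G_def H_def by (rule C) measurable
      finally show ?thesis .
    qed
    have "N r (\<lambda>s. indicator {t<..} s * (b s * G s))
        \<le> C * N r (\<lambda>s. indicator {t<..} s * (b s * G t) + indicator {t<..} s * (b s * H s))"
      by (rule N_le_cmult[OF r])
        (measurable, use GH in \<open>auto intro!: mult_left_mono split: split_indicator simp: mult.left_commute[of C] simp flip: distrib_left\<close>)
    also have "\<dots> \<le> C * (D * (N r (\<lambda>s. indicator {t<..} s * (b s * G t)) + inorm r b q {t<..} t g))"
      unfolding inorm_def H_def[symmetric] by (intro mult_left_mono D) auto
    also have "N r (\<lambda>s. indicator {t<..} s * (b s * G t)) = N r (\<lambda>s. indicator {t<..} s * b s) * G t"
    proof -
      have "N r (\<lambda>s. G t * (indicator {t<..} s * b s)) = G t * N r (\<lambda>s. indicator {t<..} s * b s)"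
        by (rule Lp_norm_cmult[OF r]) measurable
      then show ?thesis by (simp add: mult_ac)
    qed
    finally have tail: "N r (\<lambda>s. indicator {t<..} s * (b s * G s))
       \<le> C * D * (N r (\<lambda>s. indicator {t<..} s * b s) * G t + inorm r b q {t<..} t g)"
      by (simp add: mult.assoc)
    have "inorm r b q UNIV 0 g \<le> N r (\<lambda>s. indicator {..<t} s * (b s * G s) + indicator {t<..} s * (b s * G s))"
      unfolding inorm_def G_def[symmetric]
      by (rule Lp_norm_mono[OF r]) (measurable, use AE_dlog_neq[of t] in \<open>eventually_elim, auto split: split_indicator\<close>)
    also have "\<dots> \<le> D * (inorm r b q {..<t} 0 g + N r (\<lambda>s. indicator {t<..} s * (b s * G s)))"
      unfolding inorm_def G_def[symmetric] by (rule D) measurable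
    also have "\<dots> \<le> D * (inorm r b q {..<t} 0 g + C * D * (N r (\<lambda>s. indicator {t<..} s * b s) * G t + inorm r b q {t<..} t g))"
      by (intro mult_left_mono add_left_mono tail) simp
    also have "\<dots> \<le> D * ((1 + C * D) * (inorm r b q {..<t} 0 g + (N r (\<lambda>s. indicator {t<..} s * b s) * G t + inorm r b q {t<..} t g)))"
      by (intro mult_left_mono) (auto simp: distrib_right distrib_left add_mono add_increasing2 intro!: add_mono add_increasing)
    finally show ?thesis by (simp add: G_def mult.assoc add.assoc)
  qed
  then show ?thesis using C(1) D(1) by (intro exI[of _ ?E]) (auto simp: ennreal_mult_less_top)
qed

section \<open>Slowly varying weights\<close>

text \<open>\<open>k(u)/u\<close> is nonincreasing, written without dividing by possibly infinite values.\<close>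
definition quasi_concave :: "(real \<Rightarrow> ennreal) \<Rightarrow> bool" where
  "quasi_concave k \<longleftrightarrow> (\<forall>u v. 0 < u \<longrightarrow> u \<le> v \<longrightarrow> k u \<le> k v \<and> ennreal (u / v) * k v \<le> k u)"

lemma quasi_concave_measurable [measurable_dest]: "quasi_concave k \<Longrightarrow> k \<in> borel_measurable dlog"
  by (rule mono_on_measurable_dlog) (auto simp: quasi_concave_def)

locale weights =
  fixes r :: ennreal and b :: "real \<Rightarrow> ennreal" and q :: ennreal and a :: "real \<Rightarrow> ennreal"
  assumes r: "0 < r" and q: "0 < q"
    and b_measurable [measurable]: "b \<in> borel_measurable dlog"
    and a_measurable [measurable]: "a \<in> borel_measurable dlog"
    and slow_b: "slow b" and slow_a: "slow a"
    and b_pos: "\<And>t. 0 < t \<Longrightarrow> 0 < b t" and a_pos: "\<And>t. 0 < t \<Longrightarrow> 0 < a t"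
begin

abbreviation D :: "real set \<Rightarrow> real \<Rightarrow> (real \<Rightarrow> ennreal) \<Rightarrow> ennreal" where
  "D \<equiv> inorm r b q"

abbreviation tail :: "real \<Rightarrow> ennreal" where
  "tail t \<equiv> N r (\<lambda>s. indicator {t<..} s * b s)"

abbreviation head :: "real \<Rightarrow> (real \<Rightarrow> ennreal) \<Rightarrow> ennreal" where
  "head t g \<equiv> N q (\<lambda>u. indicator {0<..<t} u * g u)"

text \<open>\<open>\<chi>\<^sub>0\<close> for the weights \<open>b\<close>, \<open>a\<close>; it collects the scales above \<open>t\<close>.\<close>
definition chi_up :: "real \<Rightarrow> ennreal" where
  "chi_up t = D {t<..} t a"

text \<open>\<open>\<chi>\<^sub>1\<close> for the weights \<open>b\<close>, \<open>a\<close>; it collects the scales below \<open>t\<close> and has the two terms that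
  \<open>inorm_split\<close> leaves there.\<close>
definition chi_down :: "real \<Rightarrow> ennreal" where
  "chi_down t = D {..<t} 0 a + tail t * head t a"

lemma slow_chi_up: "slow chi_up"
proof -
  (* The inner norm is a slowly varying function of the pair (t, s). *)
  have "slow_on ({0<..} \<times> {0<..}) (\<lambda>p. N q (\<lambda>u. (\<lambda>p. indicator {fst (fst p)<..<snd (fst p)} (snd p) * a (snd p)) (p, u)))"
    by (intro slow_on_N slow_on_mult slow_on_snd slow_a q slow_on_invariant)
      (auto split: split_indicator)
  then have *: "slow_on ({0<..} \<times> {0<..}) (\<lambda>p. N q (\<lambda>u. indicator {fst p<..<snd p} u * a u))"
    by simp
  have "slow (\<lambda>t. N r (\<lambda>s. (\<lambda>p. indicator {fst p<..} (snd p) * (b (snd p) *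
      N q (\<lambda>u. indicator {fst p<..<snd p} u * a u))) (t, s)))"
    by (intro slow_on_N slow_on_mult slow_on_snd * slow_b r slow_on_invariant)
      (use q in \<open>auto split: split_indicator\<close>)
  then show ?thesis by (simp add: chi_up_def[abs_def] inorm_def)
qed

lemma slow_chi_down: "slow chi_down"
proof -
  have "slow (\<lambda>t. N r (\<lambda>s. (\<lambda>p. indicator {..<fst p} (snd p) * (b (snd p) * head (snd p) a)) (t, s)))"
    by (intro slow_on_N slow_on_mult slow_on_snd[of "\<lambda>s. head s a"] slow_on_snd[of b] slow_head
        slow_a slow_b r q slow_on_invariant)
      (use q in \<open>auto split: split_indicator\<close>)
  then show ?thesis
    unfolding chi_down_def[abs_def] inorm_def
    by (intro slow_on_add slow_on_mult slow_tail slow_head slow_a slow_b r q) auto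
qed

lemma b_le_tail: "\<exists>C<top. \<forall>t>0. b t \<le> C * tail t"
proof -
  obtain C where C: "C < top" "\<And>t. 0 < t \<Longrightarrow> b t \<le> C * N r (\<lambda>s. indicator {t<..<2 * t} s * b s)"
    using slow_le_dyadic[OF slow_b r b_measurable] by blast
  have "N r (\<lambda>s. indicator {t<..<2 * t} s * b s) \<le> tail t" for t
    by (rule N_mono[OF r], measurable) (auto split: split_indicator)
  then show ?thesis using C by (meson mult_left_mono order_trans zero_le)
qed

text \<open>The dyadic bound controls \<open>a(t)\<close> by the norm over \<open>(0,2t)\<close>, and slow variation of the norm
  over \<open>(0,t)\<close> in \<open>t\<close> removes the factor \<open>2\<close>.\<close>
lemma a_le_head: "\<exists>C<top. \<forall>t>0. a t \<le> C * head t a"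
proof -
  obtain C where C: "C < top" "\<And>t. 0 < t \<Longrightarrow> a t \<le> C * N q (\<lambda>s. indicator {t<..<2 * t} s * a s)"
    using slow_le_dyadic[OF slow_a q a_measurable] by blast
  obtain E where E: "E < top" "\<And>t u. 0 < t \<Longrightarrow> t \<le> u \<Longrightarrow> head u a \<le> E * ennreal ((u / t) powr 1) * head t a"
    using slow_potter[OF slow_head[OF slow_a q a_measurable] zero_less_one] by metis
  have "a t \<le> C * (E * 2) * head t a" if t: "0 < t" for t
  proof -
    have "N q (\<lambda>s. indicator {t<..<2 * t} s * a s) \<le> head (2 * t) a"
      by (rule N_mono[OF q], measurable) (auto split: split_indicator)
    also have "\<dots> \<le> E * 2 * head t a"
      using E(2)[of t "2 * t"] t by simp
    finally have "C * N q (\<lambda>s. indicator {t<..<2 * t} s * a s) \<le> C * (E * 2 * head t a)"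
      by (rule mult_left_mono) simp
    then show ?thesis using C(2)[OF t] by (simp add: mult.assoc)
  qed
  then show ?thesis using C(1) E(1) by (intro exI[of _ "C * (E * 2)"]) (auto simp: ennreal_mult_less_top)
qed

text \<open>Inside \<open>\<chi>\<^sub>0(t)\<close>, the region \<open>t < u < 2t < s\<close> is a product.\<close>
lemma tail_times_a_le_chi_up: "\<exists>C<top. \<forall>t>0. tail t * a t \<le> C * chi_up t"
proof -
  obtain C where C: "C < top" "\<And>t. 0 < t \<Longrightarrow> a t \<le> C * N q (\<lambda>s. indicator {t<..<2 * t} s * a s)"
    using slow_le_dyadic[OF slow_a q a_measurable] by blast
  obtain E where E: "E < top" "\<And>t u. 0 < t \<Longrightarrow> t \<le> u \<Longrightarrow> tail t \<le> E * ennreal ((u / t) powr 1) * tail u"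
    using slow_potter[OF slow_tail[OF slow_b r b_measurable] zero_less_one] by metis
  have "tail t * a t \<le> E * 2 * C * chi_up t" if t: "0 < t" for t
  proof -
    have "tail t \<le> E * 2 * tail (2 * t)"
      using E(2)[of t "2 * t"] t by simp
    then have "tail t * a t \<le> (E * 2 * tail (2 * t)) * (C * N q (\<lambda>s. indicator {t<..<2 * t} s * a s))"
      by (intro mult_mono C t) auto
    also have "\<dots> = E * 2 * C * (tail (2 * t) * N q (\<lambda>s. indicator {t<..<2 * t} s * a s))"
      by (simp add: mult_ac)
    also have "\<dots> \<le> E * 2 * C * chi_up t"
      unfolding chi_up_def
      by (intro mult_left_mono product_le_inorm r q) (use t in auto)
    finally show ?thesis .
  qed
  then show ?thesis using C(1) E(1) by (intro exI[of _ "E * 2 * C"]) (auto simp: ennreal_mult_less_top)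
qed

lemma b_times_a_le_chi_up: "\<exists>C<top. \<forall>t>0. b t * a t \<le> C * chi_up t"
proof -
  obtain C where C: "C < top" "\<And>t. 0 < t \<Longrightarrow> b t \<le> C * tail t"
    using b_le_tail by blast
  obtain E where E: "E < top" "\<And>t. 0 < t \<Longrightarrow> tail t * a t \<le> E * chi_up t"
    using tail_times_a_le_chi_up by blast
  have "b t * a t \<le> C * E * chi_up t" if t: "0 < t" for t
  proof -
    have "b t * a t \<le> C * tail t * a t" by (intro mult_right_mono C t) simp
    also have "\<dots> \<le> C * (E * chi_up t)"
      unfolding mult.assoc by (intro mult_left_mono E t) simp
    finally show ?thesis by (simp add: mult.assoc)
  qed
  then show ?thesis using C(1) E(1) by (intro exI[of _ "C * E"]) (auto simp: ennreal_mult_less_top)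
qed

lemma chi_up_pos: "0 < t \<Longrightarrow> 0 < chi_up t"
  using b_times_a_le_chi_up a_pos[of t] b_pos[of t]
  by (metis ennreal_zero_less_mult_iff le_zero_eq less_numeral_extra(3) mult_zero_right not_gr_zero)

lemma chi_down_pos:
  assumes t: "0 < t" shows "0 < chi_down t"
proof -
  have "0 < tail t"
    using b_le_tail b_pos[OF t] t by (metis le_zero_eq mult_zero_right not_gr_zero)
  moreover have "0 < head t a"
    using a_le_head a_pos[OF t] t by (metis le_zero_eq mult_zero_right not_gr_zero)
  ultimately show ?thesis
    by (simp add: chi_down_def ennreal_zero_less_mult_iff add_nonneg_pos)
qed

text \<open>Finiteness at \<open>1\<close> carries over to all \<open>t\<close> by slow variation. At \<open>1\<close> only the norm of \<open>a\<close>
  over \<open>(0,1)\<close> is missing, and its finiteness is forced by that of the iterated norm.\<close>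
lemma chi_down_finite:
  assumes fin: "tail 1 < top" "D {..<1} 0 a < top" and t: "0 < t"
  shows "chi_down t < top"
proof -
  have "N r (\<lambda>s. indicator {1/2<..<1} s * b s) * head (1/2) a \<le> D {..<1} 0 a"
    by (intro product_le_inorm r q) auto
  then have "N r (\<lambda>s. indicator {1/2<..<1} s * b s) * head (1/2) a < top"
    using fin(2) by (rule le_less_trans)
  moreover have "N r (\<lambda>s. indicator {1/2<..<1} s * b s) \<noteq> 0"
  proof
    assume 0: "N r (\<lambda>s. indicator {1/2<..<1} s * b s) = 0"
    obtain C where "\<And>t. 0 < t \<Longrightarrow> b t \<le> C * N r (\<lambda>s. indicator {t<..<2 * t} s * b s)"
      using slow_le_dyadic[OF slow_b r b_measurable] by blast
    from this[of "1/2"] 0 have "b (1/2) \<le> 0" by simp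
    then show False using b_pos[of "1/2"] by simp
  qed
  ultimately have half: "head (1/2) a < top"
    by (auto simp: ennreal_mult_less_top)
  obtain E where E: "E < top" "\<And>t u. 0 < t \<Longrightarrow> t \<le> u \<Longrightarrow> head u a \<le> E * ennreal ((u / t) powr 1) * head t a"
    using slow_potter[OF slow_head[OF slow_a q a_measurable] zero_less_one] by metis
  have "head 1 a \<le> E * ennreal ((1 / (1/2)) powr 1) * head (1/2) a" by (rule E(2)) auto
  also have "\<dots> < top" using half E(1) by (simp add: ennreal_mult_less_top)
  finally have one: "chi_down 1 < top"
    using fin by (simp add: chi_down_def ennreal_mult_less_top)
  obtain F where F: "F < top" "\<And>t u. 0 < t \<Longrightarrow> t \<le> u \<Longrightarrow> chi_down u \<le> F * ennreal ((u / t) powr 1) * chi_down t"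
    "\<And>t u. 0 < t \<Longrightarrow> t \<le> u \<Longrightarrow> chi_down t \<le> F * ennreal ((u / t) powr 1) * chi_down u"
    using slow_potter[OF slow_chi_down zero_less_one] by metis
  show ?thesis
  proof (cases "t \<le> 1")
    case True
    have "chi_down t \<le> F * ennreal ((1 / t) powr 1) * chi_down 1" using F(3) t True by blast
    also have "\<dots> < top" using F(1) one by (simp add: ennreal_mult_less_top)
    finally show ?thesis .
  next
    case False
    have "chi_down t \<le> F * ennreal ((t / 1) powr 1) * chi_down 1" by (rule F(2)) (use False in auto)
    also have "\<dots> < top" using F(1) one by (simp add: ennreal_mult_less_top)
    finally show ?thesis .
  qed
qed

text \<open>\<open>K(t,f) \<le> K(u,f)\<close> for \<open>u > t\<close>, integrated over \<open>t < u < s\<close>.\<close>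
lemma chi_up_times_le:
  assumes k: "quasi_concave k" and t: "0 < t"
  shows "chi_up t * k t \<le> D UNIV 0 (\<lambda>u. a u * k u)"
proof -
  have "k t * D {t<..} t a \<le> 1 * D UNIV 0 (\<lambda>u. a u * k u)"
  proof (intro inorm_cmult_le_cmult r q)
    fix u :: real assume "0 < u" "t < u"
    then have "k t \<le> k u" using k t by (auto simp: quasi_concave_def)
    then show "k t * a u \<le> 1 * (a u * k u)" by (simp add: mult.commute mult_left_mono)
  qed (use k t in \<open>auto dest: quasi_concave_measurable\<close>)
  then show ?thesis by (simp add: chi_up_def mult.commute)
qed

text \<open>\<open>K(t,f)/t \<le> K(u,f)/u\<close> for \<open>u < t\<close>, integrated over both regions of \<open>\<chi>\<^sub>1(t)\<close>; the factor \<open>2\<close> comes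
  from estimating these separately.\<close>
lemma chi_down_times_le:
  assumes k: "quasi_concave k" and t: "0 < t"
  shows "chi_down t * k t \<le> 2 * ennreal t * D UNIV 0 (\<lambda>u. ennreal (1 / u) * a u * k u)"
proof -
  note [measurable] = quasi_concave_measurable[OF k]
  define h where "h u = ennreal (1 / u) * a u * k u" for u
  have [measurable]: "h \<in> borel_measurable dlog" unfolding h_def by measurable
  have le: "k t * a u \<le> ennreal t * h u" if u: "0 < u" "u < t" for u
  proof -
    have "ennreal (t / u) * (ennreal (u / t) * k t) \<le> ennreal (t / u) * k u"
      using k u by (intro mult_left_mono) (auto simp: quasi_concave_def)
    moreover have "ennreal (t / u) * ennreal (u / t) = 1"
      using u t by (simp flip: ennreal_mult'')
    ultimately have "k t \<le> ennreal (t / u) * k u" by (simp flip: mult.assoc)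
    also have "ennreal (t / u) = ennreal t * ennreal (1 / u)"
      using u t by (simp flip: ennreal_mult'')
    finally have "k t * a u \<le> ennreal t * ennreal (1 / u) * k u * a u" by (rule mult_right_mono) simp
    then show ?thesis by (simp add: h_def mult_ac)
  qed
  have "k t * D {..<t} 0 a \<le> ennreal t * D UNIV 0 h"
    by (intro inorm_cmult_le_cmult r q) (use le in auto)
  moreover have "tail t * (k t * head t a) \<le> tail t * (ennreal t * head t h)"
    by (intro mult_left_mono N_cmult_le_cmult q) (use le in \<open>auto split: split_indicator\<close>)
  moreover have "tail t * head t h \<le> D UNIV 0 h"
    by (intro product_le_inorm r q) auto
  then have "ennreal t * (tail t * head t h) \<le> ennreal t * D UNIV 0 h"
    by (rule mult_left_mono) simp
  ultimately have "k t * D {..<t} 0 a + k t * (tail t * head t a) \<le> ennreal t * D UNIV 0 h + ennreal t * D UNIV 0 h"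
    by (intro add_mono) (auto simp: mult_ac)
  moreover have "chi_down t * k t = k t * D {..<t} 0 a + k t * (tail t * head t a)"
    by (simp add: chi_down_def distrib_left mult.commute[of _ "k t"])
  ultimately show ?thesis
    unfolding h_def[symmetric] by (simp add: mult_2 distrib_right)
qed

end

context weights
begin

text \<open>A positive power bounds the inner norm by the value of the integrand at its upper
  endpoint, and then the outer one as well. What remains is \<open>t\<^bsup>\<delta>\<^esup> a(t) b(t)\<close>.\<close>
lemma D_power_le_chi_up:
  assumes d: "0 < \<delta>"
  shows "\<exists>C<top. \<forall>t>0. D {..<t} 0 (\<lambda>u. ennreal (u powr \<delta>) * a u) \<le> C * (ennreal (t powr \<delta>) * chi_up t)"
proof -
  obtain C where C: "C < top" "\<And>t. 0 < t \<Longrightarrow> head t (\<lambda>u. ennreal (u powr \<delta>) * a u) \<le> C * (ennreal (t powr \<delta>) * a t)"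
    using slow_power_head[OF slow_a q a_measurable d] by blast
  obtain E where E: "E < top" "\<And>t. 0 < t \<Longrightarrow>
      N r (\<lambda>u. indicator {0<..<t} u * (ennreal (u powr \<delta>) * (b u * a u))) \<le> E * (ennreal (t powr \<delta>) * (b t * a t))"
    using slow_power_head[OF slow_on_mult[OF slow_b slow_a] r _ d] by (auto simp del: mult.assoc)
  obtain F where F: "F < top" "\<And>t. 0 < t \<Longrightarrow> b t * a t \<le> F * chi_up t"
    using b_times_a_le_chi_up by blast
  have "D {..<t} 0 (\<lambda>u. ennreal (u powr \<delta>) * a u) \<le> C * E * F * (ennreal (t powr \<delta>) * chi_up t)" if t: "0 < t" for t
  proof -
    have "D {..<t} 0 (\<lambda>u. ennreal (u powr \<delta>) * a u)
        \<le> C * N r (\<lambda>u. indicator {0<..<t} u * (ennreal (u powr \<delta>) * (b u * a u)))"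
      unfolding inorm_def
    proof (rule N_le_cmult[OF r])
      fix s :: real assume "0 < s"
      then have "b s * head s (\<lambda>u. ennreal (u powr \<delta>) * a u) \<le> b s * (C * (ennreal (s powr \<delta>) * a s))"
        by (intro mult_left_mono C) auto
      then show "indicator {..<t} s * (b s * head s (\<lambda>u. ennreal (u powr \<delta>) * a u))
          \<le> C * (indicator {0<..<t} s * (ennreal (s powr \<delta>) * (b s * a s)))"
        using \<open>0 < s\<close> by (auto simp: mult_ac split: split_indicator)
    qed (use q in measurable)
    also have "\<dots> \<le> C * (E * (ennreal (t powr \<delta>) * (F * chi_up t)))"
      by (intro mult_left_mono order_trans[OF E(2)[OF t]] F t) auto
    finally show ?thesis by (simp add: mult_ac)
  qed
  then show ?thesis using C(1) E(1) F(1) by (intro exI[of _ "C * E * F"]) (auto simp: ennreal_mult_less_top)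
qed

lemma tail_head_power_le_chi_up:
  assumes d: "0 < \<delta>"
  shows "\<exists>C<top. \<forall>t>0. tail t * head t (\<lambda>u. ennreal (u powr \<delta>) * a u) \<le> C * (ennreal (t powr \<delta>) * chi_up t)"
proof -
  obtain C where C: "C < top" "\<And>t. 0 < t \<Longrightarrow> head t (\<lambda>u. ennreal (u powr \<delta>) * a u) \<le> C * (ennreal (t powr \<delta>) * a t)"
    using slow_power_head[OF slow_a q a_measurable d] by blast
  obtain F where F: "F < top" "\<And>t. 0 < t \<Longrightarrow> tail t * a t \<le> F * chi_up t"
    using tail_times_a_le_chi_up by blast
  have "tail t * head t (\<lambda>u. ennreal (u powr \<delta>) * a u) \<le> C * F * (ennreal (t powr \<delta>) * chi_up t)" if t: "0 < t" for t
  proof -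
    have "tail t * head t (\<lambda>u. ennreal (u powr \<delta>) * a u) \<le> tail t * (C * (ennreal (t powr \<delta>) * a t))"
      by (intro mult_left_mono C t) simp
    also have "\<dots> = C * ennreal (t powr \<delta>) * (tail t * a t)" by (simp add: mult_ac)
    also have "\<dots> \<le> C * ennreal (t powr \<delta>) * (F * chi_up t)"
      by (intro mult_left_mono F t) simp
    finally show ?thesis by (simp add: mult_ac)
  qed
  then show ?thesis using C(1) F(1) by (intro exI[of _ "C * F"]) (auto simp: ennreal_mult_less_top)
qed

lemma D_power_le_chi_down:
  assumes d: "0 < \<delta>"
  shows "\<exists>C<top. \<forall>t>0. D {t<..} t (\<lambda>u. ennreal (u powr - \<delta>) * a u) \<le> C * (ennreal (t powr - \<delta>) * chi_down t)"
proof -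
  obtain C where C: "C < top" "\<And>t. 0 < t \<Longrightarrow>
      N q (\<lambda>u. indicator {t<..} u * (ennreal (u powr - \<delta>) * a u)) \<le> C * (ennreal (t powr - \<delta>) * a t)"
    using slow_power_tail[OF slow_a q a_measurable d] by blast
  obtain F where F: "F < top" "\<And>t. 0 < t \<Longrightarrow> a t \<le> F * head t a"
    using a_le_head by blast
  have "D {t<..} t (\<lambda>u. ennreal (u powr - \<delta>) * a u) \<le> C * F * (ennreal (t powr - \<delta>) * chi_down t)" if t: "0 < t" for t
  proof -
    have "D {t<..} t (\<lambda>u. ennreal (u powr - \<delta>) * a u)
      \<le> tail t * N q (\<lambda>u. indicator {t<..} u * (ennreal (u powr - \<delta>) * a u))"
      by (intro inorm_le_product r q) auto
    also have "\<dots> \<le> tail t * (C * (ennreal (t powr - \<delta>) * (F * head t a)))"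
      by (intro mult_left_mono order_trans[OF C(2)[OF t]] F t) auto
    also have "\<dots> = C * F * ennreal (t powr - \<delta>) * (tail t * head t a)" by (simp add: mult_ac)
    also have "\<dots> \<le> C * F * ennreal (t powr - \<delta>) * chi_down t"
      by (intro mult_left_mono) (auto simp: chi_down_def)
    finally show ?thesis by (simp add: mult_ac)
  qed
  then show ?thesis using C(1) F(1) by (intro exI[of _ "C * F"]) (auto simp: ennreal_mult_less_top)
qed

end

section \<open>The two sides of the equivalence\<close>

locale weight_pair =
  W0: weights r0 b0 q0 a0 + W1: weights r1 b1 q1 a1
  for r0 b0 q0 a0 r1 b1 q1 a1 +
  assumes fin: "W1.tail 1 < top" "W1.D {..<1} 0 a1 < top"
begin

text \<open>The first norm, as a functional of \<open>k(u) = K(u,f)\<close>.\<close>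
definition norm0 :: "(real \<Rightarrow> ennreal) \<Rightarrow> ennreal" where
  "norm0 k = W0.D UNIV 0 (\<lambda>u. a0 u * k u)"

text \<open>The second norm; \<open>1/u\<close> is the extra power belonging to \<open>\<theta> = 1\<close>.\<close>
definition norm1 :: "(real \<Rightarrow> ennreal) \<Rightarrow> ennreal" where
  "norm1 k = W1.D UNIV 0 (\<lambda>u. ennreal (1 / u) * a1 u * k u)"

definition rho :: "real \<Rightarrow> ennreal" where
  "rho t = ennreal t * (W0.chi_up t / W1.chi_down t)"

definition low_part :: "(real \<Rightarrow> ennreal) \<Rightarrow> real \<Rightarrow> ennreal" where
  "low_part k t = W0.D {..<t} 0 (\<lambda>u. a0 u * k u) + W0.tail t * W0.head t (\<lambda>u. a0 u * k u)"

definition high_part :: "(real \<Rightarrow> ennreal) \<Rightarrow> real \<Rightarrow> ennreal" where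
  "high_part k t = W1.D {t<..} t (\<lambda>u. ennreal (1 / u) * a1 u * k u)"

text \<open>The right-hand side of the equivalence.\<close>
definition K_bound :: "(real \<Rightarrow> ennreal) \<Rightarrow> real \<Rightarrow> ennreal" where
  "K_bound k t = low_part k t + rho t * high_part k t + W0.chi_up t * k t"

lemma low_part_le_norm0:
  assumes [measurable]: "k \<in> borel_measurable dlog" and t: "0 < t"
  shows "low_part k t \<le> 2 * norm0 k"
proof -
  have "W0.D {..<t} 0 (\<lambda>u. a0 u * k u) \<le> norm0 k"
    unfolding norm0_def by (intro inorm_mono W0.r W0.q) auto
  moreover have "W0.tail t * W0.head t (\<lambda>u. a0 u * k u) \<le> norm0 k"
    unfolding norm0_def by (intro product_le_inorm W0.r W0.q) auto
  ultimately show ?thesis unfolding low_part_def mult_2 by (rule add_mono)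
qed

text \<open>For \<open>u > t\<close>, \<open>\<chi>\<^sub>0(t) k(u) \<le> C (u/t)\<^bsup>1/2\<^esup> \<chi>\<^sub>0(u) k(u) \<le> C (u/t)\<^bsup>1/2\<^esup> \<parallel>f\<parallel>\<^sub>0\<close>. With the factor \<open>1/u\<close>
  of the second norm the power \<open>u\<^bsup>-1/2\<^esup>\<close> remains, which is enough for convergence at infinity.\<close>
lemma chi_up_high_part_le_norm0:
  "\<exists>C<top. \<forall>k t. quasi_concave k \<longrightarrow> 0 < t \<longrightarrow>
    W0.chi_up t * high_part k t \<le> C * (ennreal (1 / t) * W1.chi_down t) * norm0 k"
proof -
  have h: "0 < (1/2::real)" by simp
  obtain C where C: "C < top"
    "\<And>t u. 0 < t \<Longrightarrow> t \<le> u \<Longrightarrow> W0.chi_up t \<le> C * ennreal ((u / t) powr (1/2)) * W0.chi_up u"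
    using slow_potter[OF W0.slow_chi_up h] by metis
  obtain E where E: "E < top" "\<And>t. 0 < t \<Longrightarrow>
      W1.D {t<..} t (\<lambda>u. ennreal (u powr - (1/2)) * a1 u) \<le> E * (ennreal (t powr - (1/2)) * W1.chi_down t)"
    using W1.D_power_le_chi_down[OF h] by blast
  have "W0.chi_up t * high_part k t \<le> C * E * (ennreal (1 / t) * W1.chi_down t) * norm0 k"
    if k: "quasi_concave k" and t: "0 < t" for k t
  proof -
    note [measurable] = quasi_concave_measurable[OF k]
    have "W0.chi_up t * high_part k t \<le> (C * norm0 k * ennreal (t powr - (1/2))) * W1.D {t<..} t (\<lambda>u. ennreal (u powr - (1/2)) * a1 u)"
      unfolding high_part_def
    proof (intro inorm_cmult_le_cmult W1.r W1.q)
      fix u :: real assume u: "0 < u" "t < u"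
      have "(u / t) powr (1/2) * (1 / u) = t powr - (1/2) * u powr - (1/2)"
      proof -
        have "(u / t) powr (1/2) = u powr (1/2) * t powr - (1/2)"
          using t u by (simp add: powr_divide powr_minus_divide)
        moreover have "u powr (1/2) * (1 / u) = u powr - (1/2)"
          using u by (simp add: powr_minus_divide powr_half_sqrt real_div_sqrt field_simps)
        ultimately show ?thesis by (metis mult.assoc mult.commute)
      qed
      then have e: "ennreal ((u / t) powr (1/2)) * ennreal (1 / u) = ennreal (t powr - (1/2)) * ennreal (u powr - (1/2))"
        using u by (simp flip: ennreal_mult'')
      have "W0.chi_up t * k u \<le> C * ennreal ((u / t) powr (1/2)) * W0.chi_up u * k u"
        using u t by (intro mult_right_mono C) auto
      also have "\<dots> \<le> C * ennreal ((u / t) powr (1/2)) * norm0 k"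
        unfolding mult.assoc norm0_def by (intro mult_left_mono W0.chi_up_times_le k u) auto
      finally have "W0.chi_up t * k u * (ennreal (1 / u) * a1 u) \<le> C * ennreal ((u / t) powr (1/2)) * norm0 k * (ennreal (1 / u) * a1 u)"
        by (rule mult_right_mono) simp
      also have "\<dots> = C * (ennreal ((u / t) powr (1/2)) * ennreal (1 / u)) * norm0 k * a1 u"
        by (simp add: mult_ac)
      finally show "W0.chi_up t * (ennreal (1 / u) * a1 u * k u)
          \<le> C * norm0 k * ennreal (t powr - (1/2)) * (ennreal (u powr - (1/2)) * a1 u)"
        unfolding e by (simp add: mult_ac)
    qed auto
    also have "\<dots> \<le> (C * norm0 k * ennreal (t powr - (1/2))) * (E * (ennreal (t powr - (1/2)) * W1.chi_down t))"
      by (intro mult_left_mono E t) simp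
    also have "\<dots> = C * E * (ennreal (t powr - (1/2)) * ennreal (t powr - (1/2)) * W1.chi_down t) * norm0 k"
      by (simp add: mult_ac)
    also have "ennreal (t powr - (1/2)) * ennreal (t powr - (1/2)) = ennreal (1 / t)"
      using t by (simp add: powr_minus_divide flip: ennreal_mult'' powr_add)
    finally show ?thesis .
  qed
  then show ?thesis using C(1) E(1) by (intro exI[of _ "C * E"]) (auto simp: ennreal_mult_less_top)
qed

text \<open>For \<open>u < t\<close>, \<open>\<chi>\<^sub>1(t) k(u) \<le> C (t/u)\<^bsup>1/2\<^esup> \<chi>\<^sub>1(u) k(u) \<le> 2 C (t/u)\<^bsup>1/2\<^esup> u \<parallel>f\<parallel>\<^sub>1\<close>, so the
  power \<open>u\<^bsup>1/2\<^esup>\<close> remains, which is enough for convergence at zero.\<close>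
lemma chi_down_low_part_le_norm1:
  "\<exists>C<top. \<forall>k t. quasi_concave k \<longrightarrow> 0 < t \<longrightarrow>
    W1.chi_down t * low_part k t \<le> C * (ennreal t * W0.chi_up t) * norm1 k"
proof -
  have h: "0 < (1/2::real)" by simp
  obtain C where C: "C < top"
    "\<And>t u. 0 < t \<Longrightarrow> t \<le> u \<Longrightarrow> W1.chi_down u \<le> C * ennreal ((u / t) powr (1/2)) * W1.chi_down t"
    using slow_potter[OF W1.slow_chi_down h] by metis
  obtain E where E: "E < top" "\<And>t. 0 < t \<Longrightarrow>
      W0.D {..<t} 0 (\<lambda>u. ennreal (u powr (1/2)) * a0 u) \<le> E * (ennreal (t powr (1/2)) * W0.chi_up t)"
    using W0.D_power_le_chi_up[OF h] by blast
  obtain F where F: "F < top" "\<And>t. 0 < t \<Longrightarrow>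
      W0.tail t * W0.head t (\<lambda>u. ennreal (u powr (1/2)) * a0 u) \<le> F * (ennreal (t powr (1/2)) * W0.chi_up t)"
    using W0.tail_head_power_le_chi_up[OF h] by blast
  have "W1.chi_down t * low_part k t \<le> C * 2 * (E + F) * (ennreal t * W0.chi_up t) * norm1 k"
    if k: "quasi_concave k" and t: "0 < t" for k t
  proof -
    note [measurable] = quasi_concave_measurable[OF k]
    let ?c = "C * 2 * norm1 k * ennreal (t powr (1/2))"
    let ?g = "\<lambda>u. ennreal (u powr (1/2)) * a0 u"
    have le: "W1.chi_down t * (a0 u * k u) \<le> ?c * ?g u" if u: "0 < u" "u < t" for u
    proof -
      have "(t / u) powr (1/2) * u = t powr (1/2) * u powr (1/2)"
        using u t by (simp add: powr_divide powr_half_sqrt field_simps)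
      then have e: "ennreal ((t / u) powr (1/2)) * ennreal u = ennreal (t powr (1/2)) * ennreal (u powr (1/2))"
        using u by (simp flip: ennreal_mult'')
      have "W1.chi_down t * k u \<le> C * ennreal ((t / u) powr (1/2)) * W1.chi_down u * k u"
        using u t by (intro mult_right_mono C) auto
      also have "\<dots> \<le> C * ennreal ((t / u) powr (1/2)) * (2 * ennreal u * norm1 k)"
        unfolding mult.assoc[of _ _ "k u"] norm1_def by (intro mult_left_mono W1.chi_down_times_le k u) auto
      finally have "W1.chi_down t * k u * a0 u \<le> C * ennreal ((t / u) powr (1/2)) * (2 * ennreal u * norm1 k) * a0 u"
        by (rule mult_right_mono) simp
      also have "\<dots> = C * 2 * (ennreal ((t / u) powr (1/2)) * ennreal u) * norm1 k * a0 u"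
        by (simp add: mult_ac)
      finally show ?thesis unfolding e by (simp add: mult_ac)
    qed
    have "W1.chi_down t * W0.D {..<t} 0 (\<lambda>u. a0 u * k u) \<le> ?c * W0.D {..<t} 0 ?g"
      by (intro inorm_cmult_le_cmult W0.r W0.q) (use le in auto)
    also have "\<dots> \<le> ?c * (E * (ennreal (t powr (1/2)) * W0.chi_up t))"
      by (intro mult_left_mono E t) simp
    finally have 1: "W1.chi_down t * W0.D {..<t} 0 (\<lambda>u. a0 u * k u) \<le> ?c * (E * (ennreal (t powr (1/2)) * W0.chi_up t))" .
    have "W1.chi_down t * W0.head t (\<lambda>u. a0 u * k u) \<le> ?c * W0.head t ?g"
      by (intro N_cmult_le_cmult W0.q) (use le in \<open>auto split: split_indicator\<close>)
    then have "W0.tail t * (W1.chi_down t * W0.head t (\<lambda>u. a0 u * k u)) \<le> W0.tail t * (?c * W0.head t ?g)"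
      by (rule mult_left_mono) simp
    then have "W1.chi_down t * (W0.tail t * W0.head t (\<lambda>u. a0 u * k u)) \<le> ?c * (W0.tail t * W0.head t ?g)"
      by (simp add: mult.left_commute)
    also have "\<dots> \<le> ?c * (F * (ennreal (t powr (1/2)) * W0.chi_up t))"
      by (intro mult_left_mono F t) simp
    finally have "W1.chi_down t * low_part k t \<le> ?c * (E * (ennreal (t powr (1/2)) * W0.chi_up t)) + ?c * (F * (ennreal (t powr (1/2)) * W0.chi_up t))"
      unfolding low_part_def distrib_left by (intro add_mono 1)
    also have "\<dots> = C * 2 * (E + F) * (ennreal (t powr (1/2)) * ennreal (t powr (1/2)) * W0.chi_up t) * norm1 k"
      by (simp only: distrib_left distrib_right mult_ac)
    also have "ennreal (t powr (1/2)) * ennreal (t powr (1/2)) = ennreal t"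
      using t by (simp flip: ennreal_mult'' powr_add)
    finally show ?thesis .
  qed
  then show ?thesis using C(1) E(1) F(1)
    by (intro exI[of _ "C * 2 * (E + F)"]) (auto simp: ennreal_mult_less_top)
qed

lemma chi_down: "0 < t \<Longrightarrow> W1.chi_down t \<noteq> 0" "0 < t \<Longrightarrow> W1.chi_down t \<noteq> top"
  using W1.chi_down_pos[of t] W1.chi_down_finite[OF fin, of t] by auto

lemma rho_times_chi_down: "0 < t \<Longrightarrow> rho t * W1.chi_down t = ennreal t * W0.chi_up t"
  unfolding rho_def mult.assoc using chi_down[of t]
  by (simp add: divide_ennreal_def mult.assoc ennreal_inverse_mult mult.commute[of "inverse _"] ennreal_divide_self[unfolded divide_ennreal_def] less_top)

lemma le_if_chi_down_times_le:
  assumes "0 < t" "W1.chi_down t * x \<le> W1.chi_down t * y"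
  shows "x \<le> y"
  using assms chi_down[of t] by (simp add: ennreal_mult_le_mult_iff)

lemma rho_pos: "0 < t \<Longrightarrow> 0 < rho t"
  using rho_times_chi_down[of t] W0.chi_up_pos[of t]
  by (metis ennreal_less_zero_iff ennreal_zero_less_mult_iff mult_zero_left not_gr_zero)

lemma K_bound_le_norm0: "\<exists>C<top. \<forall>k t. quasi_concave k \<longrightarrow> 0 < t \<longrightarrow> K_bound k t \<le> C * norm0 k"
proof -
  obtain C where C: "C < top" "\<And>k t. quasi_concave k \<Longrightarrow> 0 < t \<Longrightarrow>
      W0.chi_up t * high_part k t \<le> C * (ennreal (1 / t) * W1.chi_down t) * norm0 k"
    using chi_up_high_part_le_norm0 by blast
  have "K_bound k t \<le> (2 + C + 1) * norm0 k" if k: "quasi_concave k" and t: "0 < t" for k t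
  proof -
    have "rho t * high_part k t \<le> C * norm0 k"
    proof (rule le_if_chi_down_times_le[OF t])
      have "W1.chi_down t * (rho t * high_part k t) = ennreal t * (W0.chi_up t * high_part k t)"
        using rho_times_chi_down[OF t] by (metis mult.assoc mult.commute)
      also have "\<dots> \<le> ennreal t * (C * (ennreal (1 / t) * W1.chi_down t) * norm0 k)"
        by (intro mult_left_mono C k t) simp
      also have "\<dots> = (ennreal t * ennreal (1 / t)) * (W1.chi_down t * (C * norm0 k))"
        by (simp add: mult_ac)
      also have "ennreal t * ennreal (1 / t) = 1"
        using t by (simp flip: ennreal_mult'')
      finally show "W1.chi_down t * (rho t * high_part k t) \<le> W1.chi_down t * (C * norm0 k)" by simp
    qed
    then have "K_bound k t \<le> 2 * norm0 k + C * norm0 k + norm0 k"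
      unfolding K_bound_def using low_part_le_norm0[OF quasi_concave_measurable[OF k] t] W0.chi_up_times_le[OF k t, folded norm0_def]
      by (intro add_mono)
    then show ?thesis by (simp only: distrib_right mult_1)
  qed
  then show ?thesis using C(1) by (intro exI[of _ "2 + C + 1"]) auto
qed

lemma K_bound_le_norm1: "\<exists>C<top. \<forall>k t. quasi_concave k \<longrightarrow> 0 < t \<longrightarrow> K_bound k t \<le> C * (rho t * norm1 k)"
proof -
  obtain C where C: "C < top" "\<And>k t. quasi_concave k \<Longrightarrow> 0 < t \<Longrightarrow>
      W1.chi_down t * low_part k t \<le> C * (ennreal t * W0.chi_up t) * norm1 k"
    using chi_down_low_part_le_norm1 by blast
  have "K_bound k t \<le> (C + 1 + 2) * (rho t * norm1 k)" if k: "quasi_concave k" and t: "0 < t" for k t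
  proof -
    note [measurable] = quasi_concave_measurable[OF k]
    have "W1.chi_down t * low_part k t \<le> W1.chi_down t * (C * (rho t * norm1 k))"
      using C(2)[OF k t] unfolding rho_times_chi_down[OF t, symmetric] by (simp add: mult_ac)
    then have 0: "low_part k t \<le> C * (rho t * norm1 k)" by (rule le_if_chi_down_times_le[OF t])
    have "high_part k t \<le> norm1 k"
      unfolding high_part_def norm1_def by (intro inorm_mono W1.r W1.q) (use t in auto)
    then have 1: "rho t * high_part k t \<le> 1 * (rho t * norm1 k)" by (simp add: mult_left_mono)
    have "W1.chi_down t * (W0.chi_up t * k t) = W0.chi_up t * (W1.chi_down t * k t)"
      by (simp add: mult_ac)
    also have "\<dots> \<le> W0.chi_up t * (2 * ennreal t * norm1 k)"
      unfolding norm1_def by (intro mult_left_mono W1.chi_down_times_le k t) simp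
    also have "\<dots> = 2 * (ennreal t * W0.chi_up t) * norm1 k"
      by (simp only: mult_ac)
    also have "\<dots> = W1.chi_down t * (2 * (rho t * norm1 k))"
      unfolding rho_times_chi_down[OF t, symmetric] by (simp only: mult_ac)
    finally have "W0.chi_up t * k t \<le> 2 * (rho t * norm1 k)"
      by (rule le_if_chi_down_times_le[OF t])
    then show ?thesis
      unfolding K_bound_def distrib_right using 0 1 by (intro add_mono)
  qed
  then show ?thesis using C(1) by (intro exI[of _ "C + 1 + 2"]) auto
qed

text \<open>Every term of \<open>K_bound\<close> is a monotone quasi-norm of \<open>k\<close>, possibly times a factor depending on
  \<open>t\<close> only.\<close>
lemma K_bound_quasi_subadditive:
  assumes c: "c < top"
  shows "\<exists>C<top. \<forall>k k1 k2 t. quasi_concave k \<longrightarrow> quasi_concave k1 \<longrightarrow> quasi_concave k2 \<longrightarrow> 0 < t \<longrightarrow>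
    (\<forall>u>0. k u \<le> c * (k1 u + k2 u)) \<longrightarrow> K_bound k t \<le> C * (K_bound k1 t + K_bound k2 t)"
proof -
  obtain C0 where C0: "C0 < top" "\<And>J x g h. J \<in> sets borel \<Longrightarrow> g \<in> borel_measurable dlog \<Longrightarrow> h \<in> borel_measurable dlog \<Longrightarrow>
      W0.D J x (\<lambda>u. g u + h u) \<le> C0 * (W0.D J x g + W0.D J x h)"
    using inorm_add[OF W0.r W0.q W0.b_measurable] by blast
  obtain C1 where C1: "C1 < top" "\<And>J x g h. J \<in> sets borel \<Longrightarrow> g \<in> borel_measurable dlog \<Longrightarrow> h \<in> borel_measurable dlog \<Longrightarrow>
      W1.D J x (\<lambda>u. g u + h u) \<le> C1 * (W1.D J x g + W1.D J x h)"
    using inorm_add[OF W1.r W1.q W1.b_measurable] by blast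
  obtain C2 where C2: "C2 < top" "\<And>g h. g \<in> borel_measurable dlog \<Longrightarrow> h \<in> borel_measurable dlog \<Longrightarrow>
      N q0 (\<lambda>u. g u + h u) \<le> C2 * (N q0 g + N q0 h)"
    using Lp_norm_add[OF W0.q] by blast
  define C where "C = c * (C0 + C1 + C2 + 1)"
  have "K_bound k t \<le> C * (K_bound k1 t + K_bound k2 t)"
    if k: "quasi_concave k" and k1: "quasi_concave k1" and k2: "quasi_concave k2" and t: "0 < t"
      and le: "\<And>u. 0 < u \<Longrightarrow> k u \<le> c * (k1 u + k2 u)" for k k1 k2 t
  proof -
    note [measurable] = k[THEN quasi_concave_measurable] k1[THEN quasi_concave_measurable] k2[THEN quasi_concave_measurable]
    have le': "w * k u \<le> c * (w * k1 u + w * k2 u)" if "0 < u" for u w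
      using mult_left_mono[OF le[OF that], of w] by (simp add: algebra_simps)
    have up: "c * c' * x \<le> C * x" if "c' \<le> C0 + C1 + C2 + 1" for c' x
      unfolding C_def using that by (intro mult_left_mono mult_right_mono) auto
    have "W0.D {..<t} 0 (\<lambda>u. a0 u * k u) \<le> c * W0.D {..<t} 0 (\<lambda>u. a0 u * k1 u + a0 u * k2 u)"
      by (intro inorm_le_cmult W0.r W0.q) (use le' in auto)
    also have "\<dots> \<le> c * (C0 * (W0.D {..<t} 0 (\<lambda>u. a0 u * k1 u) + W0.D {..<t} 0 (\<lambda>u. a0 u * k2 u)))"
      by (intro mult_left_mono C0) auto
    also have "\<dots> \<le> C * (W0.D {..<t} 0 (\<lambda>u. a0 u * k1 u) + W0.D {..<t} 0 (\<lambda>u. a0 u * k2 u))"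
      unfolding mult.assoc[symmetric] by (intro up) (simp add: add_increasing2)
    finally have 1: "W0.D {..<t} 0 (\<lambda>u. a0 u * k u) \<le> C * (W0.D {..<t} 0 (\<lambda>u. a0 u * k1 u) + W0.D {..<t} 0 (\<lambda>u. a0 u * k2 u))" .
    have "W0.head t (\<lambda>u. a0 u * k u) \<le> c * N q0 (\<lambda>u. indicator {0<..<t} u * (a0 u * k1 u) + indicator {0<..<t} u * (a0 u * k2 u))"
      by (intro N_le_cmult W0.q) (use le' in \<open>auto split: split_indicator\<close>)
    also have "\<dots> \<le> c * (C2 * (W0.head t (\<lambda>u. a0 u * k1 u) + W0.head t (\<lambda>u. a0 u * k2 u)))"
      by (intro mult_left_mono C2) auto
    also have "\<dots> \<le> C * (W0.head t (\<lambda>u. a0 u * k1 u) + W0.head t (\<lambda>u. a0 u * k2 u))"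
      unfolding mult.assoc[symmetric] by (intro up) (simp add: add_increasing2 add_increasing)
    finally have "W0.tail t * W0.head t (\<lambda>u. a0 u * k u) \<le> W0.tail t * (C * (W0.head t (\<lambda>u. a0 u * k1 u) + W0.head t (\<lambda>u. a0 u * k2 u)))"
      by (rule mult_left_mono) simp
    then have 2: "W0.tail t * W0.head t (\<lambda>u. a0 u * k u) \<le> C * (W0.tail t * W0.head t (\<lambda>u. a0 u * k1 u) + W0.tail t * W0.head t (\<lambda>u. a0 u * k2 u))"
      by (simp add: distrib_left mult.left_commute)
    have "high_part k t \<le> c * W1.D {t<..} t (\<lambda>u. ennreal (1 / u) * a1 u * k1 u + ennreal (1 / u) * a1 u * k2 u)"
      unfolding high_part_def by (intro inorm_le_cmult W1.r W1.q) (use le' in auto)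
    also have "\<dots> \<le> c * (C1 * (high_part k1 t + high_part k2 t))"
      unfolding high_part_def by (intro mult_left_mono C1) auto
    also have "\<dots> \<le> C * (high_part k1 t + high_part k2 t)"
      unfolding mult.assoc[symmetric] by (intro up) (simp add: add_increasing2 add_increasing)
    finally have "rho t * high_part k t \<le> rho t * (C * (high_part k1 t + high_part k2 t))"
      by (rule mult_left_mono) simp
    then have 3: "rho t * high_part k t \<le> C * (rho t * high_part k1 t + rho t * high_part k2 t)"
      by (simp add: distrib_left mult.left_commute)
    have 4: "W0.chi_up t * k t \<le> C * (W0.chi_up t * k1 t + W0.chi_up t * k2 t)"
      using order_trans[OF le'[OF t] , of "W0.chi_up t"] up[of 1] by simp
    have "K_bound k t \<le> C * (W0.D {..<t} 0 (\<lambda>u. a0 u * k1 u) + W0.D {..<t} 0 (\<lambda>u. a0 u * k2 u))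
       + C * (W0.tail t * W0.head t (\<lambda>u. a0 u * k1 u) + W0.tail t * W0.head t (\<lambda>u. a0 u * k2 u))
       + C * (rho t * high_part k1 t + rho t * high_part k2 t) + C * (W0.chi_up t * k1 t + W0.chi_up t * k2 t)"
      unfolding K_bound_def low_part_def by (intro add_mono 1 2 3 4)
    also have "\<dots> = C * (K_bound k1 t + K_bound k2 t)"
      unfolding K_bound_def low_part_def by (simp only: distrib_left add_ac)
    finally show ?thesis .
  qed
  moreover have "C < top" using c C0(1) C1(1) C2(1) by (simp add: C_def ennreal_mult_less_top)
  ultimately show ?thesis by blast
qed

text \<open>Here \<open>k0\<close> stands for \<open>K(\<cdot>,f\<^sub>0)\<close> with \<open>f\<^sub>0\<close> the first part of an almost optimal splitting of \<open>f\<close> at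
  level \<open>t\<close>: in \<open>inorm_split\<close>, the piece over \<open>t < u < s\<close> becomes \<open>\<chi>\<^sub>0(t) k(t)\<close>.\<close>
lemma norm0_le_K_bound:
  assumes c: "c < top"
  shows "\<exists>C<top. \<forall>k k0 t. quasi_concave k \<longrightarrow> quasi_concave k0 \<longrightarrow> 0 < t \<longrightarrow>
    (\<forall>u. 0 < u \<longrightarrow> u < t \<longrightarrow> k0 u \<le> c * k u) \<longrightarrow> (\<forall>u>t. k0 u \<le> c * k t) \<longrightarrow> norm0 k0 \<le> C * K_bound k t"
proof -
  obtain C where C: "C < top" "\<And>t g. 0 < t \<Longrightarrow> g \<in> borel_measurable dlog \<Longrightarrow>
     W0.D UNIV 0 g \<le> C * (W0.D {..<t} 0 g + W0.tail t * W0.head t g + W0.D {t<..} t g)"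
    using inorm_split[OF W0.r W0.q W0.b_measurable] by blast
  have "norm0 k0 \<le> C * c * K_bound k t"
    if k: "quasi_concave k" and k0: "quasi_concave k0" and t: "0 < t"
      and below: "\<And>u. 0 < u \<Longrightarrow> u < t \<Longrightarrow> k0 u \<le> c * k u" and above: "\<And>u. t < u \<Longrightarrow> k0 u \<le> c * k t" for k k0 t
  proof -
    note [measurable] = k[THEN quasi_concave_measurable] k0[THEN quasi_concave_measurable]
    have below': "a0 u * k0 u \<le> c * (a0 u * k u)" if "0 < u" "u < t" for u
      using mult_left_mono[OF below[OF that], of "a0 u"] by (simp add: mult_ac)
    have above': "a0 u * k0 u \<le> c * k t * a0 u" if "t < u" for u
      using mult_left_mono[OF above[OF that], of "a0 u"] by (simp add: mult_ac)
    have 1: "W0.D {..<t} 0 (\<lambda>u. a0 u * k0 u) \<le> c * W0.D {..<t} 0 (\<lambda>u. a0 u * k u)"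
      by (intro inorm_le_cmult W0.r W0.q) (use below' in auto)
    have "W0.head t (\<lambda>u. a0 u * k0 u) \<le> c * W0.head t (\<lambda>u. a0 u * k u)"
      by (intro N_le_cmult W0.q) (use below' in \<open>auto split: split_indicator\<close>)
    then have 2: "W0.tail t * W0.head t (\<lambda>u. a0 u * k0 u) \<le> W0.tail t * (c * W0.head t (\<lambda>u. a0 u * k u))"
      by (rule mult_left_mono) simp
    have 3: "W0.D {t<..} t (\<lambda>u. a0 u * k0 u) \<le> c * k t * W0.chi_up t"
      unfolding W0.chi_up_def by (intro inorm_le_cmult W0.r W0.q) (use above' in auto)
    have "norm0 k0 \<le> C * (W0.D {..<t} 0 (\<lambda>u. a0 u * k0 u) + W0.tail t * W0.head t (\<lambda>u. a0 u * k0 u) + W0.D {t<..} t (\<lambda>u. a0 u * k0 u))"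
      unfolding norm0_def by (intro C t) measurable
    also have "\<dots> \<le> C * (c * W0.D {..<t} 0 (\<lambda>u. a0 u * k u) + W0.tail t * (c * W0.head t (\<lambda>u. a0 u * k u)) + c * k t * W0.chi_up t)"
      by (intro mult_left_mono add_mono 1 2 3) simp
    also have "\<dots> = C * c * (low_part k t + W0.chi_up t * k t)"
      unfolding low_part_def by (simp add: distrib_left mult_ac)
    also have "\<dots> \<le> C * c * K_bound k t"
      unfolding K_bound_def by (intro mult_left_mono add_mono) auto
    finally show ?thesis .
  qed
  moreover have "C * c < top" using C(1) c by (simp add: ennreal_mult_less_top)
  ultimately show ?thesis by blast
qed

text \<open>Here \<open>k1\<close> stands for \<open>K(\<cdot>,f\<^sub>1)\<close>: in \<open>inorm_split\<close>, the pieces with \<open>u < t\<close> add up to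
  \<open>\<chi>\<^sub>1(t) k(t)/t\<close>, and \<open>\<rho> \<chi>\<^sub>1/t = \<chi>\<^sub>0\<close>.\<close>
lemma norm1_le_K_bound:
  assumes c: "c < top"
  shows "\<exists>C<top. \<forall>k k1 t. quasi_concave k \<longrightarrow> quasi_concave k1 \<longrightarrow> 0 < t \<longrightarrow>
    (\<forall>u. 0 < u \<longrightarrow> u < t \<longrightarrow> ennreal (1 / u) * k1 u \<le> c * (ennreal (1 / t) * k t)) \<longrightarrow>
    (\<forall>u>t. k1 u \<le> c * k u) \<longrightarrow> rho t * norm1 k1 \<le> C * K_bound k t"
proof -
  obtain C where C: "C < top" "\<And>t g. 0 < t \<Longrightarrow> g \<in> borel_measurable dlog \<Longrightarrow>
     W1.D UNIV 0 g \<le> C * (W1.D {..<t} 0 g + W1.tail t * W1.head t g + W1.D {t<..} t g)"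
    using inorm_split[OF W1.r W1.q W1.b_measurable] by blast
  have "rho t * norm1 k1 \<le> C * c * K_bound k t"
    if k: "quasi_concave k" and k1: "quasi_concave k1" and t: "0 < t"
      and below: "\<And>u. 0 < u \<Longrightarrow> u < t \<Longrightarrow> ennreal (1 / u) * k1 u \<le> c * (ennreal (1 / t) * k t)"
      and above: "\<And>u. t < u \<Longrightarrow> k1 u \<le> c * k u" for k k1 t
  proof -
    note [measurable] = k[THEN quasi_concave_measurable] k1[THEN quasi_concave_measurable]
    let ?g = "\<lambda>u. ennreal (1 / u) * a1 u * k1 u"
    let ?m = "c * (ennreal (1 / t) * k t)"
    have below': "?g u \<le> ?m * a1 u" if "0 < u" "u < t" for u
      using mult_left_mono[OF below[OF that], of "a1 u"] by (simp add: mult_ac)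
    have above': "?g u \<le> c * (ennreal (1 / u) * a1 u * k u)" if "t < u" for u
      using mult_left_mono[OF above[OF that], of "ennreal (1 / u) * a1 u"] by (simp add: mult_ac)
    have 1: "W1.D {..<t} 0 ?g \<le> ?m * W1.D {..<t} 0 a1"
      by (intro inorm_le_cmult W1.r W1.q) (use below' in auto)
    have "W1.head t ?g \<le> ?m * W1.head t a1"
      by (intro N_le_cmult W1.q) (use below' in \<open>auto split: split_indicator\<close>)
    then have 2: "W1.tail t * W1.head t ?g \<le> W1.tail t * (?m * W1.head t a1)"
      by (rule mult_left_mono) simp
    have 3: "W1.D {t<..} t ?g \<le> c * high_part k t"
      unfolding high_part_def by (intro inorm_le_cmult W1.r W1.q) (use above' in auto)
    have "norm1 k1 \<le> C * (W1.D {..<t} 0 ?g + W1.tail t * W1.head t ?g + W1.D {t<..} t ?g)"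
      unfolding norm1_def by (intro C t) measurable
    also have "\<dots> \<le> C * (?m * W1.D {..<t} 0 a1 + W1.tail t * (?m * W1.head t a1) + c * high_part k t)"
      by (intro mult_left_mono add_mono 1 2 3) simp
    also have "\<dots> = C * c * (ennreal (1 / t) * k t * W1.chi_down t + high_part k t)"
      unfolding W1.chi_down_def by (simp add: distrib_left mult_ac)
    finally have "rho t * norm1 k1 \<le> rho t * (C * c * (ennreal (1 / t) * k t * W1.chi_down t + high_part k t))"
      by (rule mult_left_mono) simp
    also have "\<dots> = C * c * (ennreal (1 / t) * k t * (rho t * W1.chi_down t) + rho t * high_part k t)"
      by (simp add: distrib_left mult_ac)
    also have "ennreal (1 / t) * k t * (rho t * W1.chi_down t) = (ennreal (1 / t) * ennreal t) * (W0.chi_up t * k t)"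
      unfolding rho_times_chi_down[OF t] by (simp add: mult_ac)
    also have "ennreal (1 / t) * ennreal t = 1"
      using t by (simp flip: ennreal_mult'')
    also have "C * c * (1 * (W0.chi_up t * k t) + rho t * high_part k t) \<le> C * c * K_bound k t"
      unfolding K_bound_def by (intro mult_left_mono) (auto simp: add_ac add_increasing)
    finally show ?thesis .
  qed
  moreover have "C * c < top" using C(1) c by (simp add: ennreal_mult_less_top)
  ultimately show ?thesis by blast
qed

end

section \<open>Weighted norms as norms over du/u\<close>

lemma N_cong:
  assumes q: "0 < q" and m: "f \<in> borel_measurable dlog" "g \<in> borel_measurable dlog"
    and eq: "\<And>u. 0 < u \<Longrightarrow> f u = g u"
  shows "N q f = N q g"
  by (intro antisym N_mono q m) (simp_all add: eq)

lemma Lq_eq_N_indicator: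
  assumes q: "0 < q" and I: "I = J \<inter> {0<..}" and J: "J \<in> sets borel"
    and g [measurable]: "g \<in> borel_measurable dlog"
    and w: "\<And>u. u \<in> I \<Longrightarrow> w u = ennreal (u powr (- enn2real (1 / q))) * g u"
  shows "Lq q I w = N q (\<lambda>u. indicator J u * g u)"
proof -
  note [measurable] = J
  have [measurable]: "I \<in> sets borel" unfolding I by measurable
  have "Lq q I w = N q (\<lambda>u. indicator I u * g u)"
  proof (rule Lq_eq_N[OF q _ _ g w])
    show "I \<subseteq> {0<..}" by (simp add: I)
    show "I \<in> sets lebesgue"
      using \<open>I \<in> sets borel\<close> by (metis sets_completionI_sets sets_lborel)
  qed
  also have "\<dots> = N q (\<lambda>u. indicator J u * g u)"
  proof (rule N_cong[OF q])
    show "(\<lambda>u. indicator I u * g u) \<in> borel_measurable dlog"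
      by measurable
    show "(\<lambda>u. indicator J u * g u) \<in> borel_measurable dlog"
      by measurable
    show "indicator I u * g u = indicator J u * g u" if "0 < u" for u
      using that by (simp add: I indicator_def)
  qed
  finally show ?thesis .
qed

lemma weight_eq:
  "weight 0 q a u = ennreal (u powr (- enn2real (1 / q))) * ennreal (a u)"
  "0 < u \<Longrightarrow> weight 1 q a u = ennreal (u powr (- enn2real (1 / q))) * (ennreal (1 / u) * ennreal (a u))"
proof -
  show "weight 0 q a u = ennreal (u powr (- enn2real (1 / q))) * ennreal (a u)"
    unfolding weight_def minus_zero diff_0 by (rule ennreal_mult') simp
  assume u: "0 < u"
  have "u powr (- 1 - enn2real (1 / q)) = u powr (- enn2real (1 / q)) * u powr (- 1)"
    by (simp only: powr_add[symmetric] diff_conv_add_uminus add.commute)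
  then have "u powr (- 1 - enn2real (1 / q)) = u powr (- enn2real (1 / q)) * (1 / u)"
    using u by (simp add: powr_minus_divide)
  then show "weight 1 q a u = ennreal (u powr (- enn2real (1 / q))) * (ennreal (1 / u) * ennreal (a u))"
    unfolding weight_def
    using u by (simp only: mult.assoc ennreal_mult' powr_ge_zero zero_le_divide_1_iff less_imp_le)
qed

lemma Lq_iterated_eq_inorm:
  assumes r: "0 < r" and q: "0 < q" and I: "I = J \<inter> {0<..}" and J: "J \<in> sets borel" and x: "0 \<le> x"
    and g: "g \<in> borel_measurable dlog" and b [measurable]: "(\<lambda>s. ennreal (b s)) \<in> borel_measurable dlog"
    and w: "\<And>u. 0 < u \<Longrightarrow> w u = ennreal (u powr (- enn2real (1 / q))) * g u"
  shows "Lq r I (\<lambda>s. weight 0 r b s * Lq q {x<..<s} w) = inorm r (\<lambda>s. ennreal (b s)) q J x g"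
  unfolding inorm_def
proof (rule Lq_eq_N_indicator[OF r I J])
  fix s assume "s \<in> I"
  then have s: "0 < s" by (simp add: I)
  have "Lq q {x<..<s} w = N q (\<lambda>u. indicator {x<..<s} u * g u)"
    by (rule Lq_eq_N_indicator[OF q]) (use x g w in auto)
  then show "weight 0 r b s * Lq q {x<..<s} w =
      ennreal (s powr - enn2real (1 / r)) * (ennreal (b s) * N q (\<lambda>u. indicator {x<..<s} u * g u))"
    by (simp add: weight_eq s mult.assoc)
qed (use q g in measurable)

section \<open>The K-functional\<close>

lemma K_fun_le:
  "f0 \<in> pts A0 \<Longrightarrow> f1 \<in> pts A1 \<Longrightarrow> K_fun t (f0 + f1) A0 A1 \<le> qnorm A0 f0 + t * qnorm A1 f1"
  unfolding K_fun_def by (rule Inf_lower) blast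

lemma K_fun_decomposition:
  assumes "K_fun t f A0 A1 < c"
  obtains f0 f1 where "f0 \<in> pts A0" "f1 \<in> pts A1" "f = f0 + f1" "qnorm A0 f0 + t * qnorm A1 f1 < c"
  using assms unfolding K_fun_def Inf_less_iff by blast

lemma quasi_concave_K_fun: "quasi_concave (\<lambda>u. K_fun (ennreal u) f A0 A1)"
  unfolding quasi_concave_def
proof (intro allI impI conjI)
  fix u v :: real assume uv: "0 < u" "u \<le> v"
  show "K_fun (ennreal u) f A0 A1 \<le> K_fun (ennreal v) f A0 A1"
    unfolding K_fun_def[of "ennreal v"]
  proof (rule Inf_greatest, clarify)
    fix f0 f1 assume "f0 \<in> pts A0" "f1 \<in> pts A1"
    then have "K_fun (ennreal u) (f0 + f1) A0 A1 \<le> qnorm A0 f0 + ennreal u * qnorm A1 f1"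
      by (rule K_fun_le)
    also have "\<dots> \<le> qnorm A0 f0 + ennreal v * qnorm A1 f1"
      using uv by (intro add_left_mono mult_right_mono ennreal_leI) auto
    finally show "K_fun (ennreal u) (f0 + f1) A0 A1 \<le> qnorm A0 f0 + ennreal v * qnorm A1 f1" .
  qed
  show "ennreal (u / v) * K_fun (ennreal v) f A0 A1 \<le> K_fun (ennreal u) f A0 A1"
    unfolding K_fun_def[of "ennreal u"]
  proof (rule Inf_greatest, clarify)
    fix f0 f1 assume "f0 \<in> pts A0" "f1 \<in> pts A1"
    then have "ennreal (u / v) * K_fun (ennreal v) (f0 + f1) A0 A1
        \<le> ennreal (u / v) * (qnorm A0 f0 + ennreal v * qnorm A1 f1)"
      by (intro mult_left_mono K_fun_le) auto
    also have "\<dots> = ennreal (u / v) * qnorm A0 f0 + ennreal u * qnorm A1 f1"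
      using uv by (simp add: distrib_left flip: mult.assoc ennreal_mult'')
    also have "\<dots> \<le> 1 * qnorm A0 f0 + ennreal u * qnorm A1 f1"
      using uv by (intro add_right_mono mult_right_mono) auto
    finally show "ennreal (u / v) * K_fun (ennreal v) (f0 + f1) A0 A1 \<le> qnorm A0 f0 + ennreal u * qnorm A1 f1"
      by simp
  qed
qed

text \<open>The infimum of a set of sums with independent summands; the sets may be empty or have infimum
  \<open>\<infinity>\<close>.\<close>
lemma le_Inf_plus_Inf:
  fixes A B :: "ennreal set"
  assumes le: "\<And>x y. x \<in> A \<Longrightarrow> y \<in> B \<Longrightarrow> z \<le> x + y"
  shows "z \<le> Inf A + Inf B"
proof (rule ennreal_le_epsilon)
  fix e :: real assume fin: "Inf A + Inf B < top" and e: "0 < e"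
  have less: "a < a + ennreal (e / 2)" if "a < top" for a :: ennreal
    using that e by (cases a) (auto simp: ennreal_less_iff simp flip: ennreal_plus)
  obtain x where x: "x \<in> A" "x < Inf A + ennreal (e / 2)"
    using less[of "Inf A"] fin by (auto simp: Inf_less_iff)
  obtain y where y: "y \<in> B" "y < Inf B + ennreal (e / 2)"
    using less[of "Inf B"] fin by (auto simp: Inf_less_iff)
  have "z \<le> x + y" using le x y by blast
  also have "\<dots> \<le> (Inf A + ennreal (e / 2)) + (Inf B + ennreal (e / 2))"
    using x y by (intro add_mono) auto
  also have "\<dots> = Inf A + Inf B + (ennreal (e / 2) + ennreal (e / 2))"
    by (simp add: add_ac)
  also have "ennreal (e / 2) + ennreal (e / 2) = ennreal e"
    using e by (simp flip: ennreal_plus)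
  finally show "z \<le> Inf A + Inf B + ennreal e" .
qed

lemma quasi_normedD:
  assumes "quasi_normed X"
  shows "subspace (pts X)" "x \<in> pts X \<Longrightarrow> qnorm X x < top" "qnorm X 0 = 0"
    "x \<in> pts X \<Longrightarrow> qnorm X (- x) = qnorm X x"
proof -
  show s: "subspace (pts X)" and "x \<in> pts X \<Longrightarrow> qnorm X x < top"
    using assms by (auto simp: quasi_normed_def)
  show "qnorm X 0 = 0"
    using assms subspace_0[OF s] by (auto simp: quasi_normed_def)
  assume "x \<in> pts X"
  then have "qnorm X ((-1) *\<^sub>R x) = ennreal \<bar>-1\<bar> * qnorm X x"
    using assms unfolding quasi_normed_def by blast
  then show "qnorm X (- x) = qnorm X x" by simp
qed

lemma quasi_normed_triangle:
  assumes "quasi_normed X"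
  obtains C where "C \<ge> 1"
    "\<And>x y. x \<in> pts X \<Longrightarrow> y \<in> pts X \<Longrightarrow> qnorm X (x + y) \<le> ennreal C * (qnorm X x + qnorm X y)"
proof -
  have "\<exists>C\<ge>1. \<forall>x\<in>pts X. \<forall>y\<in>pts X. qnorm X (x + y) \<le> ennreal C * (qnorm X x + qnorm X y)"
    using assms unfolding quasi_normed_def by (elim conjE)
  then obtain C where "C \<ge> 1 \<and> (\<forall>x\<in>pts X. \<forall>y\<in>pts X. qnorm X (x + y) \<le> ennreal C * (qnorm X x + qnorm X y))"
    by (rule exE)
  then show ?thesis by (intro that) (erule conjunct1, drule conjunct2, drule bspec, assumption, erule bspec)
qed

lemma K_fun_quasi_subadditive:
  assumes A0: "quasi_normed A0" and A1: "quasi_normed A1"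
  shows "\<exists>C<top. \<forall>u f g. K_fun u (f + g) A0 A1 \<le> C * (K_fun u f A0 A1 + K_fun u g A0 A1)"
proof -
  obtain c0 where c0: "c0 \<ge> 1" "\<And>x y. x \<in> pts A0 \<Longrightarrow> y \<in> pts A0 \<Longrightarrow> qnorm A0 (x + y) \<le> ennreal c0 * (qnorm A0 x + qnorm A0 y)"
    using quasi_normed_triangle[OF A0] by metis
  obtain c1 where c1: "c1 \<ge> 1" "\<And>x y. x \<in> pts A1 \<Longrightarrow> y \<in> pts A1 \<Longrightarrow> qnorm A1 (x + y) \<le> ennreal c1 * (qnorm A1 x + qnorm A1 y)"
    using quasi_normed_triangle[OF A1] by metis
  define c where "c = max c0 c1"
  have c: "c \<ge> 1" "c0 \<le> c" "c1 \<le> c" using c0(1) by (auto simp: c_def)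
  have "K_fun u (f + g) A0 A1 \<le> ennreal c * (K_fun u f A0 A1 + K_fun u g A0 A1)" for u f g
  proof -
    have "ennreal (1 / c) * K_fun u (f + g) A0 A1 \<le> K_fun u f A0 A1 + K_fun u g A0 A1"
      unfolding K_fun_def[of u f] K_fun_def[of u g]
    proof (rule le_Inf_plus_Inf, clarify)
      fix f0 f1 g0 g1 assume f: "f0 \<in> pts A0" "f1 \<in> pts A1" and g: "g0 \<in> pts A0" "g1 \<in> pts A1"
      have "K_fun u (f0 + f1 + (g0 + g1)) A0 A1 = K_fun u ((f0 + g0) + (f1 + g1)) A0 A1"
        by (simp add: add_ac)
      also have "\<dots> \<le> qnorm A0 (f0 + g0) + u * qnorm A1 (f1 + g1)"
        by (intro K_fun_le subspace_add quasi_normedD A0 A1 f g)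
      also have "\<dots> \<le> ennreal c * (qnorm A0 f0 + qnorm A0 g0) + u * (ennreal c * (qnorm A1 f1 + qnorm A1 g1))"
        using c by (intro add_mono mult_left_mono order_trans[OF c0(2)] order_trans[OF c1(2)] mult_right_mono ennreal_leI f g) auto
      also have "\<dots> = ennreal c * (qnorm A0 f0 + u * qnorm A1 f1 + (qnorm A0 g0 + u * qnorm A1 g1))"
        by (simp add: distrib_left mult_ac add_ac)
      finally have "ennreal (1 / c) * K_fun u (f0 + f1 + (g0 + g1)) A0 A1
         \<le> ennreal (1 / c) * (ennreal c * (qnorm A0 f0 + u * qnorm A1 f1 + (qnorm A0 g0 + u * qnorm A1 g1)))"
        by (rule mult_left_mono) simp
      then show "ennreal (1 / c) * K_fun u (f0 + f1 + (g0 + g1)) A0 A1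
         \<le> qnorm A0 f0 + u * qnorm A1 f1 + (qnorm A0 g0 + u * qnorm A1 g1)"
        using c by (simp flip: mult.assoc ennreal_mult'')
    qed
    then have "ennreal c * (ennreal (1 / c) * K_fun u (f + g) A0 A1) \<le> ennreal c * (K_fun u f A0 A1 + K_fun u g A0 A1)"
      by (rule mult_left_mono) simp
    then show ?thesis using c by (simp flip: mult.assoc ennreal_mult'')
  qed
  then show ?thesis by (intro exI[of _ "ennreal c"]) auto
qed

lemma continuously_embedded_tendsto_0:
  assumes "continuously_embedded X" "\<And>n. s n \<in> pts X" "(\<lambda>n. qnorm X (s n)) \<longlonglongrightarrow> 0"
  shows "s \<longlonglongrightarrow> 0"
proof (rule topological_tendstoI)
  fix U :: "'a set" assume "open U" "0 \<in> U"
  then obtain e where e: "e > 0" "\<And>x. x \<in> pts X \<Longrightarrow> qnorm X x < e \<Longrightarrow> x \<in> U"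
    using assms(1) unfolding continuously_embedded_def by blast
  show "eventually (\<lambda>n. s n \<in> U) sequentially"
    using order_tendstoD(2)[OF assms(3) e(1)] by eventually_elim (use e(2) assms(2) in blast)
qed

text \<open>The one place where the ambient topology enters: the parts of ever better decompositions tend to
  \<open>0\<close> in the Hausdorff ambient space, and so does their constant sum \<open>f\<close>.\<close>
lemma K_fun_eq_0:
  assumes couple: "compatible_couple A0 A1" and t: "0 < t" and 0: "K_fun (ennreal t) f A0 A1 = 0"
  shows "f = 0"
proof -
  have "\<exists>f0 f1. f0 \<in> pts A0 \<and> f1 \<in> pts A1 \<and> f = f0 + f1 \<and>
      qnorm A0 f0 + ennreal t * qnorm A1 f1 < ennreal (inverse (real (Suc n)))" for n
  proof -
    have "K_fun (ennreal t) f A0 A1 < ennreal (inverse (real (Suc n)))"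
      unfolding 0 by (simp add: ennreal_less_zero_iff)
    then show ?thesis by (rule K_fun_decomposition) blast
  qed
  then obtain f0 f1 where f: "\<And>n. f0 n \<in> pts A0" "\<And>n. f1 n \<in> pts A1" "\<And>n. f = f0 n + f1 n"
      "\<And>n. qnorm A0 (f0 n) + ennreal t * qnorm A1 (f1 n) < ennreal (inverse (real (Suc n)))"
    by metis
  have "(\<lambda>n. qnorm A0 (f0 n)) \<longlonglongrightarrow> 0"
  proof (rule tendsto_sandwich[OF _ _ tendsto_const])
    show "(\<lambda>n. ennreal (inverse (real (Suc n)))) \<longlonglongrightarrow> 0"
      using tendsto_ennrealI[OF LIMSEQ_inverse_real_of_nat] by simp
    show "\<forall>\<^sub>F n in sequentially. qnorm A0 (f0 n) \<le> ennreal (inverse (real (Suc n)))"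
      using f(4) by (intro always_eventually allI) (meson add_increasing2 dual_order.strict_implies_order dual_order.trans le_add_same_cancel1 order_refl zero_le)
  qed auto
  then have "f0 \<longlonglongrightarrow> 0"
    using couple f(1) by (intro continuously_embedded_tendsto_0[of A0]) (auto simp: compatible_couple_def)
  moreover have "(\<lambda>n. qnorm A1 (f1 n)) \<longlonglongrightarrow> 0"
  proof (rule tendsto_sandwich[OF _ _ tendsto_const])
    show "(\<lambda>n. ennreal (1 / t * inverse (real (Suc n)))) \<longlonglongrightarrow> 0"
      using tendsto_ennrealI[OF tendsto_mult_right_zero[OF LIMSEQ_inverse_real_of_nat, of "1 / t"]] by simp
    have "qnorm A1 (f1 n) \<le> ennreal (1 / t * inverse (real (Suc n)))" for n
    proof -
      have "ennreal t * qnorm A1 (f1 n) \<le> qnorm A0 (f0 n) + ennreal t * qnorm A1 (f1 n)"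
        by simp
      then have "ennreal t * qnorm A1 (f1 n) \<le> ennreal (inverse (real (Suc n)))"
        using f(4)[of n] by (rule order_trans[OF _ less_imp_le])
      then have "ennreal (1 / t) * (ennreal t * qnorm A1 (f1 n)) \<le> ennreal (1 / t) * ennreal (inverse (real (Suc n)))"
        by (rule mult_left_mono) simp
      moreover have "ennreal (1 / t) * ennreal t = 1" using t by (simp flip: ennreal_mult'')
      ultimately show ?thesis using t by (simp only: mult.assoc[symmetric] mult_1 ennreal_mult'[of "1 / t"] zero_le_divide_1_iff less_imp_le)
    qed
    then show "\<forall>\<^sub>F n in sequentially. qnorm A1 (f1 n) \<le> ennreal (1 / t * inverse (real (Suc n)))"
      by simp
  qed auto
  then have "f1 \<longlonglongrightarrow> 0"
    using couple f(2) by (intro continuously_embedded_tendsto_0[of A1]) (auto simp: compatible_couple_def)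
  ultimately have "(\<lambda>n. f0 n + f1 n) \<longlonglongrightarrow> 0 + 0" by (rule tendsto_add)
  then have "(\<lambda>n. f) \<longlonglongrightarrow> 0" using f(3) by simp
  then show "f = 0" using LIMSEQ_unique[OF tendsto_const] by blast
qed

section \<open>The spaces and weights in terms of du/u\<close>

lemma slowly_varying_measurable:
  assumes "slowly_varying b"
  shows "(\<lambda>u. ennreal (b u)) \<in> borel_measurable dlog"
proof -
  have [measurable]: "b \<in> borel_measurable (lebesgue_on {0<..})"
    using assms unfolding slowly_varying_def by (elim conjE)
  show ?thesis unfolding borel_measurable_dlog_iff by measurable
qed

lemma weights_slowly_varying:
  assumes "0 < r" "0 < q" "slowly_varying b" "slowly_varying a"
  shows "weights r (\<lambda>u. ennreal (b u)) q (\<lambda>u. ennreal (a u))"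
  using assms by (intro weights.intro slowly_varying_measurable slow_on_slowly_varying)
    (auto simp: slowly_varying_def ennreal_less_zero_iff)

context
  fixes r q :: ennreal and a b :: "real \<Rightarrow> real"
  assumes rq: "0 < r" "0 < q" and sv: "slowly_varying b" "slowly_varying a"
begin

interpretation weights r "\<lambda>u. ennreal (b u)" q "\<lambda>u. ennreal (a u)"
  by (rule weights_slowly_varying[OF rq sv])

lemma Lq_tail_eq: "0 < t \<Longrightarrow> Lq r {t<..} (weight 0 r b) = tail t"
  by (rule Lq_eq_N_indicator[OF rq(1)]) (auto simp: weight_eq)

lemma Lq_head_eq:
  assumes [measurable]: "k \<in> borel_measurable dlog"
  shows "Lq q {0<..<t} (\<lambda>u. weight 0 q a u * k u) = head t (\<lambda>u. ennreal (a u) * k u)"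
  by (rule Lq_eq_N_indicator[OF rq(2)]) (auto simp: weight_eq mult.assoc)

lemma Lq_head_weight_eq: "Lq q {0<..<t} (weight 0 q a) = head t (\<lambda>u. ennreal (a u))"
  by (rule Lq_eq_N_indicator[OF rq(2)]) (auto simp: weight_eq)

lemma Lq_iterated_weight_eq:
  assumes "I = J \<inter> {0<..}" "J \<in> sets borel" "0 \<le> x"
  shows "Lq r I (\<lambda>s. weight 0 r b s * Lq q {x<..<s} (weight 0 q a)) = D J x (\<lambda>u. ennreal (a u))"
  by (rule Lq_iterated_eq_inorm[OF rq assms]) (auto simp: weight_eq)

lemma Lq_iterated_weight0_eq:
  assumes "I = J \<inter> {0<..}" "J \<in> sets borel" "0 \<le> x" and [measurable]: "k \<in> borel_measurable dlog"
  shows "Lq r I (\<lambda>s. weight 0 r b s * Lq q {x<..<s} (\<lambda>u. weight 0 q a u * k u))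
    = D J x (\<lambda>u. ennreal (a u) * k u)"
  by (rule Lq_iterated_eq_inorm[OF rq assms(1-3)]) (auto simp: weight_eq mult.assoc)

lemma Lq_iterated_weight1_eq:
  assumes "I = J \<inter> {0<..}" "J \<in> sets borel" "0 \<le> x" and [measurable]: "k \<in> borel_measurable dlog"
  shows "Lq r I (\<lambda>s. weight 0 r b s * Lq q {x<..<s} (\<lambda>u. weight 1 q a u * k u))
    = D J x (\<lambda>u. ennreal (1 / u) * ennreal (a u) * k u)"
  by (rule Lq_iterated_eq_inorm[OF rq assms(1-3)]) (measurable, simp add: weight_eq(2) mult.assoc)

lemma chi0_eq: "0 < t \<Longrightarrow> chi0 r b q a t = chi_up t"
  unfolding chi0_def chi_up_def by (rule Lq_iterated_weight_eq) auto

lemma chi1_eq: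
  assumes t: "0 < t"
  shows "chi1 r b q a t = chi_down t"
proof -
  have "{0<..<t} = {..<t} \<inter> {0<..}" by auto
  then show ?thesis
    unfolding chi1_def chi_down_def Lq_tail_eq[OF t] Lq_head_weight_eq[of t]
    by (simp only: Lq_iterated_weight_eq[OF _ lessThan_borel order_refl])
qed

lemma L_norm_0_eq:
  "L_norm 0 r b q a A0 A1 f = D UNIV 0 (\<lambda>u. ennreal (a u) * K_fun (ennreal u) f A0 A1)"
  unfolding L_norm_def
  by (rule Lq_iterated_weight0_eq) (auto intro: quasi_concave_measurable quasi_concave_K_fun)

lemma L_norm_1_eq:
  "L_norm 1 r b q a A0 A1 f = D UNIV 0 (\<lambda>u. ennreal (1 / u) * ennreal (a u) * K_fun (ennreal u) f A0 A1)"
  unfolding L_norm_def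
  by (rule Lq_iterated_weight1_eq) (auto intro: quasi_concave_measurable quasi_concave_K_fun)

end

section \<open>The equivalence\<close>

text \<open>For \<open>K(t,f) > 0\<close> the factor \<open>2\<close> leaves room above the infimum; for \<open>K(t,f) = 0\<close> one has \<open>f = 0\<close>.\<close>
lemma optimal_decomposition:
  assumes couple: "compatible_couple A0 A1" and f: "f \<in> sum_pts A0 A1" and t: "0 < t"
  obtains f0 f1 where "f0 \<in> pts A0" "f1 \<in> pts A1" "f = f0 + f1"
    "qnorm A0 f0 + ennreal t * qnorm A1 f1 \<le> 2 * K_fun (ennreal t) f A0 A1"
proof -
  have A: "quasi_normed A0" "quasi_normed A1"
    using couple by (auto simp: compatible_couple_def quasi_banach_def)
  let ?K = "K_fun (ennreal t) f A0 A1"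
  show ?thesis
  proof (cases "?K = 0")
    case True
    then have "f = 0" by (rule K_fun_eq_0[OF couple t])
    then show ?thesis
      using that[of 0 0] A by (simp add: quasi_normedD(1) quasi_normedD(3) subspace_0)
  next
    case False
    obtain g0 g1 where g: "g0 \<in> pts A0" "g1 \<in> pts A1" "f = g0 + g1"
      using f by (auto simp: sum_pts_def)
    have "?K \<le> qnorm A0 g0 + ennreal t * qnorm A1 g1"
      unfolding g(3) by (rule K_fun_le[OF g(1,2)])
    also have "\<dots> < top"
      using quasi_normedD(2)[OF A(1) g(1)] quasi_normedD(2)[OF A(2) g(2)] by (simp add: ennreal_mult_less_top)
    finally have "?K + 0 < ?K + ?K"
      using False unfolding ennreal_add_left_cancel_less by (simp add: zero_less_iff_neq_zero)
    then have "?K < 2 * ?K" by (simp only: mult_2 add_0_right)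
    then show ?thesis by (rule K_fun_decomposition) (use that in auto)
  qed
qed

theorem theorem30:
  fixes A0 A1 :: "'v::real_tvs qspace"
    and q0 r0 q1 r1 :: ennreal
    and a0 b0 a1 b1 :: "real \<Rightarrow> real"
    and \<rho> :: "real \<Rightarrow> ennreal"
    and X0 X1 :: "'v qspace"
  assumes couple: "compatible_couple A0 A1"
    and inter: "pts A0 \<inter> pts A1 \<noteq> {0}"
    and q1: "0 < q1" and r1: "0 < r1"
    and sv1: "slowly_varying a1" "slowly_varying b1"
    and fin1: "Lq r1 {1<..} (weight 0 r1 b1) < \<infinity>"
      "Lq r1 {0<..<1} (\<lambda>s. weight 0 r1 b1 s * Lq q1 {0<..<s} (weight 0 q1 a1)) < \<infinity>"
    and q0: "0 < q0" and r0: "0 < r0"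
    and sv0: "slowly_varying a0" "slowly_varying b0"
    and fin0: "Lq r0 {1<..} (\<lambda>s. weight 0 r0 b0 s * Lq q0 {1<..<s} (weight 0 q0 a0)) < \<infinity>"
    and rho: "\<And>t. \<rho> t = ennreal t * (chi0 r0 b0 q0 a0 t / chi1 r1 b1 q1 a1 t)"
    and X0: "X0 = L_space 0 r0 b0 q0 a0 A0 A1"
    and X1: "X1 = L_space 1 r1 b1 q1 a1 A0 A1"
    and nontrivial: "pts X0 \<noteq> {0}" "pts X1 \<noteq> {0}"
  shows "\<exists>C::real. C > 0 \<and> (\<forall>f \<in> sum_pts X0 X1. \<forall>t>0.
    let L = K_fun (\<rho> t) f X0 X1;
        R = Lq r0 {0<..<t} (\<lambda>s. weight 0 r0 b0 s *
              Lq q0 {0<..<s} (\<lambda>u. weight 0 q0 a0 u * K_fun (ennreal u) f A0 A1))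
          + Lq r0 {t<..} (weight 0 r0 b0) *
              Lq q0 {0<..<t} (\<lambda>u. weight 0 q0 a0 u * K_fun (ennreal u) f A0 A1)
          + \<rho> t * Lq r1 {t<..} (\<lambda>s. weight 0 r1 b1 s *
              Lq q1 {t<..<s} (\<lambda>u. weight 1 q1 a1 u * K_fun (ennreal u) f A0 A1))
          + chi0 r0 b0 q0 a0 t * K_fun (ennreal t) f A0 A1
    in ennreal (1 / C) * R \<le> L \<and> L \<le> ennreal C * R)"
proof -
  interpret W: weight_pair r0 "\<lambda>u. ennreal (b0 u)" q0 "\<lambda>u. ennreal (a0 u)"
    r1 "\<lambda>u. ennreal (b1 u)" q1 "\<lambda>u. ennreal (a1 u)"
  proof (intro weight_pair.intro weight_pair_axioms.intro weights_slowly_varying r0 q0 r1 q1 sv0 sv1)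
    show "N r1 (\<lambda>s. indicator {1<..} s * ennreal (b1 s)) < top"
      using fin1(1) Lq_tail_eq[OF r1 q1 sv1(2,1), of 1] by simp
    show "inorm r1 (\<lambda>u. ennreal (b1 u)) q1 {..<1} 0 (\<lambda>u. ennreal (a1 u)) < top"
    proof -
      have "{0<..<1} = {..<1::real} \<inter> {0<..}" by auto
      from Lq_iterated_weight_eq[OF r1 q1 sv1(2,1) this lessThan_borel order_refl] fin1(2)
      show ?thesis by simp
    qed
  qed
  have A: "quasi_normed A0" "quasi_normed A1"
    using couple by (auto simp: compatible_couple_def quasi_banach_def)
  define k where "k f u = K_fun (ennreal u) f A0 A1" for f u
  have qc: "quasi_concave (k f)" for f
    unfolding k_def by (rule quasi_concave_K_fun)
  note [measurable] = quasi_concave_measurable[OF qc]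
  have \<rho>: "\<rho> t = W.rho t" if "0 < t" for t
    using chi0_eq[OF r0 q0 sv0(2,1) that] chi1_eq[OF r1 q1 sv1(2,1) that] by (simp add: rho W.rho_def)
  have qnorm0: "qnorm X0 f = W.norm0 (k f)" for f
    by (simp add: X0 L_space_def W.norm0_def k_def L_norm_0_eq[OF r0 q0 sv0(2,1)])
  have qnorm1: "qnorm X1 f = W.norm1 (k f)" for f
    by (simp add: X1 L_space_def W.norm1_def k_def L_norm_1_eq[OF r1 q1 sv1(2,1)])
  have pts0: "pts X0 = {f \<in> sum_pts A0 A1. W.norm0 (k f) < top}"
    using qnorm0 by (simp add: X0 L_space_def)
  have pts1: "pts X1 = {f \<in> sum_pts A0 A1. W.norm1 (k f) < top}"
    using qnorm1 by (simp add: X1 L_space_def)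

  obtain c where c: "c < top" "\<And>u f g. k (f + g) u \<le> c * (k f u + k g u)"
    using K_fun_quasi_subadditive[OF A] unfolding k_def by blast

  obtain C1 where C1: "C1 < top" "\<And>k k1 k2 t. quasi_concave k \<Longrightarrow> quasi_concave k1 \<Longrightarrow> quasi_concave k2 \<Longrightarrow> 0 < t \<Longrightarrow>
      (\<And>u. 0 < u \<Longrightarrow> k u \<le> c * (k1 u + k2 u)) \<Longrightarrow> W.K_bound k t \<le> C1 * (W.K_bound k1 t + W.K_bound k2 t)"
    using W.K_bound_quasi_subadditive[OF c(1)] by metis
  obtain C2 where C2: "C2 < top" "\<And>k t. quasi_concave k \<Longrightarrow> 0 < t \<Longrightarrow> W.K_bound k t \<le> C2 * W.norm0 k"
    using W.K_bound_le_norm0 by metis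
  obtain C3 where C3: "C3 < top" "\<And>k t. quasi_concave k \<Longrightarrow> 0 < t \<Longrightarrow> W.K_bound k t \<le> C3 * (W.rho t * W.norm1 k)"
    using W.K_bound_le_norm1 by metis
  have lower: "W.K_bound (k (f0 + f1)) t \<le> C1 * (C2 + C3) * (W.norm0 (k f0) + W.rho t * W.norm1 (k f1))" if t: "0 < t" for f0 f1 t
  proof -
    have "W.K_bound (k (f0 + f1)) t \<le> C1 * (W.K_bound (k f0) t + W.K_bound (k f1) t)"
      by (intro C1 qc t c)
    also have "\<dots> \<le> C1 * (C2 * W.norm0 (k f0) + C3 * (W.rho t * W.norm1 (k f1)))"
      by (intro mult_left_mono add_mono C2 C3 qc t) simp
    also have "\<dots> \<le> C1 * ((C2 + C3) * W.norm0 (k f0) + (C2 + C3) * (W.rho t * W.norm1 (k f1)))"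
      by (intro mult_left_mono add_mono mult_right_mono) auto
    finally show ?thesis by (simp only: distrib_left[of "C2 + C3", symmetric] mult.assoc)
  qed

  (* Quasi-subadditivity of K in f0 = f - f1 gives the factor c (1 + 2), because K(u,f1) is at most
     2 K(u,f) for u < t, and likewise for f1 = f - f0 and u > t; the summand 2 covers the direct bounds by 2 K(t,f). *)
  have c2: "c * (1 + 2) + 2 < top"
    using c(1) by (simp add: ennreal_mult_less_top)
  let ?c = "c * (1 + 2) + 2"
  obtain C4 where C4: "C4 < top" "\<And>k k0 t. quasi_concave k \<Longrightarrow> quasi_concave k0 \<Longrightarrow> 0 < t \<Longrightarrow>
    (\<And>u. 0 < u \<Longrightarrow> u < t \<Longrightarrow> k0 u \<le> ?c * k u) \<Longrightarrow> (\<And>u. t < u \<Longrightarrow> k0 u \<le> ?c * k t) \<Longrightarrow> W.norm0 k0 \<le> C4 * W.K_bound k t"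
    using W.norm0_le_K_bound[OF c2] by metis
  obtain C5 where C5: "C5 < top" "\<And>k k1 t. quasi_concave k \<Longrightarrow> quasi_concave k1 \<Longrightarrow> 0 < t \<Longrightarrow>
    (\<And>u. 0 < u \<Longrightarrow> u < t \<Longrightarrow> ennreal (1 / u) * k1 u \<le> ?c * (ennreal (1 / t) * k t)) \<Longrightarrow>
    (\<And>u. t < u \<Longrightarrow> k1 u \<le> ?c * k u) \<Longrightarrow> W.rho t * W.norm1 k1 \<le> C5 * W.K_bound k t"
    using W.norm1_le_K_bound[OF c2] by metis
  have upper: "\<exists>f0 f1. f0 \<in> sum_pts A0 A1 \<and> f1 \<in> sum_pts A0 A1 \<and> f = f0 + f1 \<and>
      W.norm0 (k f0) \<le> C4 * W.K_bound (k f) t \<and> W.rho t * W.norm1 (k f1) \<le> C5 * W.K_bound (k f) t"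
    if f: "f \<in> sum_pts A0 A1" and t: "0 < t" for f t
  proof -
    obtain f0 f1 where d: "f0 \<in> pts A0" "f1 \<in> pts A1" "f = f0 + f1"
        "qnorm A0 f0 + ennreal t * qnorm A1 f1 \<le> 2 * k f t"
      using optimal_decomposition[OF couple f t] unfolding k_def by blast
    have z: "0 \<in> pts A0" "0 \<in> pts A1"
      using A by (auto intro: subspace_0 quasi_normedD)
    have n0: "qnorm A0 f0 \<le> 2 * k f t"
      by (rule order_trans[OF _ d(4)]) simp
    have n1: "ennreal t * qnorm A1 f1 \<le> 2 * k f t"
      by (rule order_trans[OF _ d(4)]) simp
    have n1': "qnorm A1 f1 \<le> 2 * (ennreal (1 / t) * k f t)"
    proof -
      have "ennreal (1 / t) * ennreal t = 1" using t by (simp flip: ennreal_mult'')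
      then have "qnorm A1 f1 = ennreal (1 / t) * ennreal t * qnorm A1 f1" by (simp only: mult_1)
      also have "\<dots> \<le> ennreal (1 / t) * (2 * k f t)"
        unfolding mult.assoc by (intro mult_left_mono n1) simp
      finally show ?thesis by (simp only: mult_ac)
    qed
    have k0: "k f0 u \<le> qnorm A0 f0" for u
      using K_fun_le[OF d(1) z(2), of "ennreal u"] by (simp add: k_def quasi_normedD(3)[OF A(2)])
    have k1: "k g u \<le> ennreal u * qnorm A1 g" if "g \<in> pts A1" for g u
      using K_fun_le[OF z(1) that, of "ennreal u"] by (simp add: k_def quasi_normedD(3)[OF A(1)])
    have m: "- f1 \<in> pts A1" by (rule subspace_neg[OF quasi_normedD(1)[OF A(2)] d(2)])
    have f0: "f0 = f + (- f1)" and f1: "f1 = f + (- f0)" by (simp_all add: d(3))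
    have bound0: "k f0 u \<le> ?c * k f u" if u: "0 < u" "u < t" for u
    proof -
      have "k (- f1) u \<le> ennreal u * qnorm A1 f1"
        using k1[OF m] by (simp add: quasi_normedD(4)[OF A(2) d(2)])
      also have "\<dots> \<le> ennreal u * (2 * (ennreal (1 / t) * k f t))"
        by (intro mult_left_mono n1') simp
      also have "\<dots> = 2 * (ennreal (u / t) * k f t)"
        using u t by (simp add: mult_ac divide_inverse ennreal_mult')
      also have "\<dots> \<le> 2 * k f u"
        using qc[of f] u by (intro mult_left_mono) (auto simp: quasi_concave_def)
      finally have "k f0 u \<le> c * (k f u + 2 * k f u)"
        using c(2)[of f "- f1" u] unfolding f0[symmetric]
        by (meson add_left_mono mult_left_mono order_trans zero_le)
      also have "\<dots> = c * (1 + 2) * k f u"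
        by (simp only: distrib_left distrib_right mult_1_right mult.assoc)
      also have "\<dots> \<le> ?c * k f u" by (intro mult_right_mono) auto
      finally show ?thesis .
    qed
    have bound1: "k f1 u \<le> ?c * k f u" if u: "t < u" for u
    proof -
      have m0: "- f0 \<in> pts A0" by (rule subspace_neg[OF quasi_normedD(1)[OF A(1)] d(1)])
      have "k (- f0) u \<le> qnorm A0 f0"
        using K_fun_le[OF m0 z(2), of "ennreal u"]
        by (simp add: k_def quasi_normedD(3)[OF A(2)] quasi_normedD(4)[OF A(1) d(1)])
      also have "\<dots> \<le> 2 * k f t" by (rule n0)
      also have "\<dots> \<le> 2 * k f u"
        using qc[of f] u t by (intro mult_left_mono) (auto simp: quasi_concave_def)
      finally have "k f1 u \<le> c * (k f u + 2 * k f u)"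
        using c(2)[of f "- f0" u] unfolding f1[symmetric]
        by (meson add_left_mono mult_left_mono order_trans zero_le)
      also have "\<dots> = c * (1 + 2) * k f u"
        by (simp only: distrib_left distrib_right mult_1_right mult.assoc)
      also have "\<dots> \<le> ?c * k f u" by (intro mult_right_mono) auto
      finally show ?thesis .
    qed
    have le2: "2 * x \<le> ?c * x" for x by (intro mult_right_mono) auto
    have "W.norm0 (k f0) \<le> C4 * W.K_bound (k f) t"
      by (intro C4 qc t bound0 order_trans[OF k0 order_trans[OF n0 le2]])
    moreover have "W.rho t * W.norm1 (k f1) \<le> C5 * W.K_bound (k f) t"
    proof (intro C5 qc t bound1)
      fix u assume u: "0 < u" "u < t"
      have "ennreal (1 / u) * k f1 u \<le> ennreal (1 / u) * (ennreal u * qnorm A1 f1)"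
        by (intro mult_left_mono k1 d) simp
      also have "\<dots> = qnorm A1 f1"
        using u by (simp flip: mult.assoc ennreal_mult'')
      also have "\<dots> \<le> ?c * (ennreal (1 / t) * k f t)"
        by (rule order_trans[OF n1' le2])
      finally show "ennreal (1 / u) * k f1 u \<le> ?c * (ennreal (1 / t) * k f t)" .
    qed
    moreover have "f0 \<in> sum_pts A0 A1" "f1 \<in> sum_pts A0 A1"
      using d(1,2) z unfolding sum_pts_def by force+
    ultimately show ?thesis using d(3) by blast
  qed

  define B where "B = C1 * (C2 + C3) + (C4 + C5) + 1"
  have B: "B < top" using C1(1) C2(1) C3(1) C4(1) C5(1) by (simp add: B_def ennreal_mult_less_top)
  define C where "C = enn2real B"
  have BC: "ennreal C = B" using B by (simp add: C_def)
  have C0: "0 < C"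
    unfolding C_def enn2real_positive_iff using B by (simp add: B_def add_pos_nonneg add_nonneg_pos)

  have main: "ennreal (1 / C) * W.K_bound (k f) t \<le> K_fun (\<rho> t) f X0 X1 \<and> K_fun (\<rho> t) f X0 X1 \<le> ennreal C * W.K_bound (k f) t"
    if f: "f \<in> sum_pts X0 X1" and t: "0 < t" for f t
  proof
    show "ennreal (1 / C) * W.K_bound (k f) t \<le> K_fun (\<rho> t) f X0 X1"
      unfolding K_fun_def
    proof (rule Inf_greatest, clarify)
      fix f0 f1
      have "W.K_bound (k (f0 + f1)) t \<le> C1 * (C2 + C3) * (W.norm0 (k f0) + W.rho t * W.norm1 (k f1))"
        by (rule lower[OF t])
      also have "\<dots> \<le> ennreal C * (W.norm0 (k f0) + W.rho t * W.norm1 (k f1))"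
        unfolding BC B_def by (intro mult_right_mono) (auto simp: add.assoc)
      finally have "ennreal (1 / C) * W.K_bound (k (f0 + f1)) t \<le> ennreal (1 / C) * (ennreal C * (W.norm0 (k f0) + W.rho t * W.norm1 (k f1)))"
        by (rule mult_left_mono) simp
      also have "\<dots> = W.norm0 (k f0) + W.rho t * W.norm1 (k f1)"
        using C0 by (simp flip: mult.assoc ennreal_mult'')
      finally show "ennreal (1 / C) * W.K_bound (k (f0 + f1)) t \<le> qnorm X0 f0 + \<rho> t * qnorm X1 f1"
        by (simp add: qnorm0 qnorm1 \<rho>[OF t])
    qed
    show "K_fun (\<rho> t) f X0 X1 \<le> ennreal C * W.K_bound (k f) t"
    proof (cases "W.K_bound (k f) t = top")
      case True
      then show ?thesis using C0 by (simp add: ennreal_mult_top)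
    next
      case False
      have "f \<in> sum_pts A0 A1"
      proof -
        obtain g0 g1 where g: "f = g0 + g1" "g0 \<in> sum_pts A0 A1" "g1 \<in> sum_pts A0 A1"
          using f pts0 pts1 unfolding sum_pts_def[of X0 X1] by auto
        then obtain h0 h1 h2 h3 where h: "g0 = h0 + h1" "g1 = h2 + h3" "h0 \<in> pts A0" "h1 \<in> pts A1" "h2 \<in> pts A0" "h3 \<in> pts A1"
          unfolding sum_pts_def by blast
        have "f = (h0 + h2) + (h1 + h3)" by (simp add: g h add_ac)
        moreover have "h0 + h2 \<in> pts A0" "h1 + h3 \<in> pts A1"
          using h A by (auto intro: subspace_add quasi_normedD)
        ultimately show ?thesis unfolding sum_pts_def by blast
      qed
      then obtain f0 f1 where d: "f0 \<in> sum_pts A0 A1" "f1 \<in> sum_pts A0 A1" "f = f0 + f1"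
          "W.norm0 (k f0) \<le> C4 * W.K_bound (k f) t" "W.rho t * W.norm1 (k f1) \<le> C5 * W.K_bound (k f) t"
        using upper[OF _ t] by blast
      have "C4 * W.K_bound (k f) t < top" "C5 * W.K_bound (k f) t < top"
        using C4(1) C5(1) False by (auto simp: ennreal_mult_less_top top.not_eq_extremum)
      then have "W.norm0 (k f0) < top" "W.rho t * W.norm1 (k f1) < top"
        using d(4,5) by (auto elim: le_less_trans)
      (* As rho is positive, finiteness of the second product makes the norm of f1 finite. *)
      then have "f0 \<in> pts X0" "f1 \<in> pts X1"
        using d(1,2) W.rho_pos[OF t] by (auto simp: pts0 pts1 ennreal_mult_less_top)
      then have "K_fun (\<rho> t) f X0 X1 \<le> W.norm0 (k f0) + W.rho t * W.norm1 (k f1)"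
        unfolding d(3) qnorm0[symmetric] qnorm1[symmetric] \<rho>[OF t, symmetric] by (rule K_fun_le)
      also have "\<dots> \<le> C4 * W.K_bound (k f) t + C5 * W.K_bound (k f) t"
        by (intro add_mono d)
      also have "\<dots> = (C4 + C5) * W.K_bound (k f) t" by (simp only: distrib_right)
      also have "\<dots> \<le> ennreal C * W.K_bound (k f) t"
        unfolding BC B_def by (intro mult_right_mono) (auto simp: add_increasing add_increasing2)
      finally show ?thesis .
    qed
  qed
  have R_eq: "Lq r0 {0<..<t} (\<lambda>s. weight 0 r0 b0 s *
              Lq q0 {0<..<s} (\<lambda>u. weight 0 q0 a0 u * k f u))
          + Lq r0 {t<..} (weight 0 r0 b0) *
              Lq q0 {0<..<t} (\<lambda>u. weight 0 q0 a0 u * k f u)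
          + \<rho> t * Lq r1 {t<..} (\<lambda>s. weight 0 r1 b1 s *
              Lq q1 {t<..<s} (\<lambda>u. weight 1 q1 a1 u * k f u))
          + chi0 r0 b0 q0 a0 t * k f t = W.K_bound (k f) t" if t: "0 < t" for f t
  proof -
    have 1: "{0<..<t} = {..<t} \<inter> {0<..}" and 2: "{t<..} = {t<..} \<inter> {0<..}" using t by auto
    show ?thesis
      unfolding W.K_bound_def W.low_part_def W.high_part_def
        Lq_iterated_weight0_eq[OF r0 q0 sv0(2,1) 1 lessThan_borel order_refl quasi_concave_measurable[OF qc]]
        Lq_iterated_weight1_eq[OF r1 q1 sv1(2,1) 2 greaterThan_borel less_imp_le[OF t] quasi_concave_measurable[OF qc]]
        Lq_tail_eq[OF r0 q0 sv0(2,1) t] Lq_head_eq[OF r0 q0 sv0(2,1) quasi_concave_measurable[OF qc], where t = t]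
        chi0_eq[OF r0 q0 sv0(2,1) t] \<rho>[OF t] ..
  qed
  show ?thesis
    using C0 main R_eq unfolding k_def Let_def by (intro exI[of _ C]) simp
qed

end
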